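(* Let $K_n=(M_n,g,F)$ be an $n$-dimensional Kähler space with Ricci tensor $R_{ij}$, scalar curvature $R$, and energy-momentum tensor $T_{ij}=R_{ij}-\tfrac12 R\,g_{ij}$. Then $K_n$ satisfies at least one of the two conditions ($\Omega_2$) $\;T_{ij,k}-T_{ik,j}=0$, ($\Omega_3$) $\;$there exist covector fields $a_i$, $b_i$ on $M_n$ such that $T_{ij,k}=a_k g_{ij}+b_i g_{jk}+b_j g_{ik}$, if and only if $$T_{ij,k}=0\quad\text{and}\quad R_{ij,k}=0 .$$
   Context: All objects are sufficiently smooth (say $C^\infty$) and considerations are local. A Kähler space $K_n$ is an $n$-dimensional (pseudo-)Riemannian manifold $(M_n,g)$ (the metric $g$ is nondegenerate of arbitrary signature) together with a tensor field $F=(F^h_i)$ of type $(1,1)$ such that $$F^h_\alpha F^\alpha_i=-\delta^h_i,\qquad F^\alpha_i g_{\alpha j}+F^\alpha_j g_{\alpha i}=0,\qquad F^h_{i,j}=0 .$$ The comma denotes the covariant derivative with respect to the Levi-Civita connection of $g$, and repeated indices are summed. $R_{ij}$ is the Ricci tensor of $g$, $R=g^{ij}R_{ij}$ is the scalar curvature, and $g^{ij}$ is the inverse of $g_{ij}$. The energy-momentum tensor is defined by Einstein's equation $R_{ij}-\tfrac12 R\,g_{ij}=T_{ij}$.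
   Formalization: The dimension n > 2 is assumed: for n = 2 one always has T_{ij} = 0, so both conditions hold, while R_{ij,k} = (1/2) R_{,k} g_{ij} is nonzero on any oriented surface of nonconstant curvature, so the statement fails there. *)

theory Defs
  imports "HOL-Analysis.Analysis"
begin

section \<open>Smooth functions on open subsets of coordinate space\<close>

definition partial :: "'n::finite \<Rightarrow> (real^'n \<Rightarrow> real) \<Rightarrow> real^'n \<Rightarrow> real" where
  "partial k f x = frechet_derivative f (at x) (axis k 1)"

text \<open>On an open set \<open>U\<close>, \<open>C_k m U f\<close> says that \<open>f\<close> is of class \<open>C^m\<close>.\<close>

fun C_k :: "nat \<Rightarrow> (real^'n::finite) set \<Rightarrow> (real^'n \<Rightarrow> real) \<Rightarrow> bool" where
  "C_k 0 U f \<longleftrightarrow> continuous_on U f"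
| "C_k (Suc m) U f \<longleftrightarrow> f differentiable_on U \<and> (\<forall>k. C_k m U (partial k f))"

definition smooth :: "(real^'n::finite) set \<Rightarrow> (real^'n \<Rightarrow> real) \<Rightarrow> bool" where
  "smooth U f \<longleftrightarrow> (\<forall>m. C_k m U f)"


section \<open>Smooth manifolds\<close>

text \<open>A chart is a domain together with a coordinate map.\<close>

type_synonym ('a, 'n) chart = "'a set \<times> ('a \<Rightarrow> real^'n)"

definition chart_im :: "('a, 'n::finite) chart \<Rightarrow> (real^'n) set" where
  "chart_im c = snd c ` fst c"

definition overlap :: "('a, 'n::finite) chart \<Rightarrow> ('a, 'n) chart \<Rightarrow> (real^'n) set" where
  "overlap c d = snd c ` (fst c \<inter> fst d)"

definition transition :: "('a, 'n::finite) chart \<Rightarrow> ('a, 'n) chart \<Rightarrow> real^'n \<Rightarrow> real^'n" where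
  "transition c d x = snd d (inv_into (fst c) (snd c) x)"

definition is_chart :: "'a topology \<Rightarrow> ('a, 'n::finite) chart \<Rightarrow> bool" where
  "is_chart M c \<longleftrightarrow> openin M (fst c) \<and> open (chart_im c) \<and>
     homeomorphic_map (subtopology M (fst c)) (top_of_set (chart_im c)) (snd c)"

definition smooth_manifold :: "'a topology \<Rightarrow> ('a, 'n::finite) chart set \<Rightarrow> bool" where
  "smooth_manifold M A \<longleftrightarrow>
     Hausdorff_space M \<and> second_countable M \<and>
     (\<forall>c\<in>A. is_chart M c) \<and> (\<Union>c\<in>A. fst c) = topspace M \<and>
     (\<forall>c\<in>A. \<forall>d\<in>A. \<forall>i. smooth (overlap c d) (\<lambda>x. transition c d x $ i))"

text \<open>The Jacobian matrix of the change of coordinates from \<open>c\<close> to \<open>d\<close>.\<close>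

definition jac :: "('a, 'n::finite) chart \<Rightarrow> ('a, 'n) chart \<Rightarrow> real^'n \<Rightarrow> real^'n^'n" where
  "jac c d x = (\<chi> i j. partial j (\<lambda>y. transition c d y $ i) x)"


section \<open>Tensor fields\<close>

text \<open>
  A tensor field is given by its components in every chart of the atlas, as functions of the
  coordinates in that chart (only the values on \<open>chart_im c\<close> matter), subject to the usual
  transformation law. A (0,2) field has \<open>t c x $ i $ j\<close> as its \<open>ij\<close> component; in a (1,1) field
  the first index is the upper one.
\<close>

type_synonym ('a, 'n) vec_comps = "('a, 'n) chart \<Rightarrow> real^'n \<Rightarrow> real^'n"
type_synonym ('a, 'n) mat_comps = "('a, 'n) chart \<Rightarrow> real^'n \<Rightarrow> real^'n^'n"

definition covector_field :: "('a, 'n::finite) chart set \<Rightarrow> ('a, 'n) vec_comps \<Rightarrow> bool" where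
  "covector_field A w \<longleftrightarrow>
     (\<forall>c\<in>A. \<forall>i. smooth (chart_im c) (\<lambda>x. w c x $ i)) \<and>
     (\<forall>c\<in>A. \<forall>d\<in>A. \<forall>x\<in>overlap c d.
        w c x = transpose (jac c d x) *v w d (transition c d x))"

definition tensor_field_02 :: "('a, 'n::finite) chart set \<Rightarrow> ('a, 'n) mat_comps \<Rightarrow> bool" where
  "tensor_field_02 A t \<longleftrightarrow>
     (\<forall>c\<in>A. \<forall>i j. smooth (chart_im c) (\<lambda>x. t c x $ i $ j)) \<and>
     (\<forall>c\<in>A. \<forall>d\<in>A. \<forall>x\<in>overlap c d.
        t c x = transpose (jac c d x) ** t d (transition c d x) ** jac c d x)"

definition tensor_field_11 :: "('a, 'n::finite) chart set \<Rightarrow> ('a, 'n) mat_comps \<Rightarrow> bool" where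
  "tensor_field_11 A t \<longleftrightarrow>
     (\<forall>c\<in>A. \<forall>h i. smooth (chart_im c) (\<lambda>x. t c x $ h $ i)) \<and>
     (\<forall>c\<in>A. \<forall>d\<in>A. \<forall>x\<in>overlap c d.
        t c x = jac d c (transition c d x) ** t d (transition c d x) ** jac c d x)"


section \<open>Levi-Civita connection and curvature in coordinates\<close>

text \<open>
  Here \<open>g\<close> is the matrix of metric components in one fixed chart.
  \<open>christoffel g h i j\<close> has \<open>h\<close> as its upper index.
\<close>

definition christoffel ::
    "(real^'n \<Rightarrow> real^'n^'n) \<Rightarrow> 'n::finite \<Rightarrow> 'n \<Rightarrow> 'n \<Rightarrow> real^'n \<Rightarrow> real" where
  "christoffel g h i j x =
     (1/2) * (\<Sum>m\<in>UNIV. matrix_inv (g x) $ h $ m *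
        (partial i (\<lambda>y. g y $ m $ j) x + partial j (\<lambda>y. g y $ m $ i) x
           - partial m (\<lambda>y. g y $ i $ j) x))"

text \<open>In both covariant derivatives the last index \<open>k\<close> is the direction of differentiation.\<close>

definition cov_deriv_02 ::
    "(real^'n \<Rightarrow> real^'n^'n) \<Rightarrow> (real^'n \<Rightarrow> real^'n^'n) \<Rightarrow> 'n::finite \<Rightarrow> 'n \<Rightarrow> 'n \<Rightarrow> real^'n \<Rightarrow> real" where
  "cov_deriv_02 g t i j k x =
     partial k (\<lambda>y. t y $ i $ j) x
     - (\<Sum>m\<in>UNIV. christoffel g m i k x * t x $ m $ j)
     - (\<Sum>m\<in>UNIV. christoffel g m j k x * t x $ i $ m)"

definition cov_deriv_11 ::
    "(real^'n \<Rightarrow> real^'n^'n) \<Rightarrow> (real^'n \<Rightarrow> real^'n^'n) \<Rightarrow> 'n::finite \<Rightarrow> 'n \<Rightarrow> 'n \<Rightarrow> real^'n \<Rightarrow> real" where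
  "cov_deriv_11 g t h i k x =
     partial k (\<lambda>y. t y $ h $ i) x
     + (\<Sum>m\<in>UNIV. christoffel g h m k x * t x $ m $ i)
     - (\<Sum>m\<in>UNIV. christoffel g m i k x * t x $ h $ m)"

text \<open>
  \<open>riemann g h i j k\<close> is the component with upper index \<open>h\<close> and lower indices \<open>i j k\<close>; the Ricci
  tensor contracts \<open>h\<close> with \<open>j\<close>, so that round spheres have positive Ricci curvature.
\<close>

definition riemann ::
    "(real^'n \<Rightarrow> real^'n^'n) \<Rightarrow> 'n::finite \<Rightarrow> 'n \<Rightarrow> 'n \<Rightarrow> 'n \<Rightarrow> real^'n \<Rightarrow> real" where
  "riemann g h i j k x =
     partial j (christoffel g h i k) x - partial k (christoffel g h i j) x
     + (\<Sum>m\<in>UNIV. christoffel g m i k x * christoffel g h m j x)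
     - (\<Sum>m\<in>UNIV. christoffel g m i j x * christoffel g h m k x)"

definition ricci :: "(real^'n \<Rightarrow> real^'n^'n) \<Rightarrow> real^'n \<Rightarrow> real^'n^('n::finite)" where
  "ricci g x = (\<chi> i j. \<Sum>m\<in>UNIV. riemann g m i m j x)"

definition scalar_curvature :: "(real^'n \<Rightarrow> real^'n^'n) \<Rightarrow> real^('n::finite) \<Rightarrow> real" where
  "scalar_curvature g x = (\<Sum>i\<in>UNIV. \<Sum>j\<in>UNIV. matrix_inv (g x) $ i $ j * ricci g x $ i $ j)"

definition energy_momentum :: "(real^'n \<Rightarrow> real^'n^'n) \<Rightarrow> real^'n \<Rightarrow> real^'n^('n::finite)" where
  "energy_momentum g x =
     (\<chi> i j. ricci g x $ i $ j - (1/2) * scalar_curvature g x * g x $ i $ j)"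


section \<open>Kaehler spaces\<close>

definition pseudo_riemannian ::
    "'a topology \<Rightarrow> ('a, 'n::finite) chart set \<Rightarrow> ('a, 'n) mat_comps \<Rightarrow> bool" where
  "pseudo_riemannian M A g \<longleftrightarrow>
     smooth_manifold M A \<and> tensor_field_02 A g \<and>
     (\<forall>c\<in>A. \<forall>x\<in>chart_im c. (\<forall>i j. g c x $ i $ j = g c x $ j $ i) \<and> invertible (g c x))"

definition kaehler_space ::
    "'a topology \<Rightarrow> ('a, 'n::finite) chart set \<Rightarrow> ('a, 'n) mat_comps \<Rightarrow> ('a, 'n) mat_comps \<Rightarrow> bool" where
  "kaehler_space M A g F \<longleftrightarrow>
     pseudo_riemannian M A g \<and> tensor_field_11 A F \<and>
     (\<forall>c\<in>A. \<forall>x\<in>chart_im c.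
        (\<forall>h i. (\<Sum>m\<in>UNIV. F c x $ h $ m * F c x $ m $ i) = - (if h = i then 1 else 0)) \<and>
        (\<forall>i j. (\<Sum>m\<in>UNIV. F c x $ m $ i * g c x $ m $ j)
             + (\<Sum>m\<in>UNIV. F c x $ m $ j * g c x $ m $ i) = 0) \<and>
        (\<forall>h i j. cov_deriv_11 (g c) (F c) h i j x = 0))"

end

theory Submission
  imports Defs
begin

text \<open>
  In a chart, write \<open>\<Gamma>\<^sub>k\<close> for the matrix of Christoffel symbols with last index \<open>k\<close>. Then
  \<open>\<partial>\<^sub>k g = \<Gamma>\<^sub>k\<^sup>T g + g \<Gamma>\<^sub>k\<close>, \<open>\<partial>\<^sub>k F = F \<Gamma>\<^sub>k - \<Gamma>\<^sub>k F\<close>, and the curvature is the matrix-valued 2-form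
  \<open>\<partial>\<^sub>j \<Gamma>\<^sub>k - \<partial>\<^sub>k \<Gamma>\<^sub>j + [\<Gamma>\<^sub>j, \<Gamma>\<^sub>k]\<close>, which commutes with \<open>F\<close>. Hence the Ricci form
  \<open>\<omega> = F\<^sup>T Ric\<close> is antisymmetric, and it is closed because \<open>2 \<omega>\<close> is the trace of \<open>F\<close> times the
  curvature. It follows that \<open>F\<^sup>T \<nabla>\<^sub>k T\<close> is antisymmetric.

  Under \<open>\<Omega>\<^sub>2\<close> the array \<open>F\<^sup>m\<^sub>i T\<^sub>m\<^sub>j\<^sub>,\<^sub>k\<close> is antisymmetric in \<open>i, j\<close> and symmetric in \<open>j, k\<close>, so it vanishes.
  Under \<open>\<Omega>\<^sub>3\<close> this antisymmetry, contracted with the inverse metric, gives \<open>b = 0\<close>; then \<open>\<nabla>\<^sub>k Ric\<close>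
  is a multiple \<open>c\<^sub>k\<close> of \<open>g\<close>, and closedness of \<open>\<omega>\<close> contracts to \<open>(n - 2) c = 0\<close>.
  Finally, \<open>T\<^sub>i\<^sub>j\<^sub>,\<^sub>k = 0\<close> gives \<open>(1 - n / 2) \<partial>\<^sub>k R = 0\<close> by contraction, so the Ricci tensor is parallel too.
\<close>

section \<open>Calculus of smooth functions\<close>

lemma partial_eq:
  assumes "(f has_derivative f') (at x)"
  shows "partial k f x = f' (axis k 1)"
  unfolding partial_def using frechet_derivative_at[OF assms] by simp

lemma differentiable_onD:
  fixes f :: "real^'n \<Rightarrow> real"
  assumes "f differentiable_on U" "open U" "x \<in> U"
  shows "(f has_derivative frechet_derivative f (at x)) (at x)"
  using assms differentiable_on_eq_differentiable_at frechet_derivative_works by blast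

text \<open>\<open>frechet_derivative\<close> is a choice among the maps satisfying
  \<open>has_derivative\<close>. Functions that agree near \<open>x\<close> have the same such maps,
  so the choice is the same, even where no derivative exists.\<close>

lemma partial_cong:
  assumes "open U" "x \<in> U" "\<And>y. y \<in> U \<Longrightarrow> f y = h y"
  shows "partial k f x = partial k h x"
proof -
  have "(f has_derivative D) (at x) \<longleftrightarrow> (h has_derivative D) (at x)" for D
    using assms has_derivative_transform_within_open[of _ D x UNIV U] by (metis)
  then show ?thesis
    unfolding partial_def frechet_derivative_def by simp
qed

lemma partial_const [simp]: "partial k (\<lambda>y. c) x = 0"
  by (simp add: partial_def)

lemma C_k_cong:
  assumes "open U" "\<And>y. y \<in> U \<Longrightarrow> f y = h y"
  shows "C_k m U f \<longleftrightarrow> C_k m U h"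
  using assms(2)
proof (induction m arbitrary: f h)
  case 0
  then show ?case by (simp cong: continuous_on_cong)
next
  case (Suc m)
  have "f differentiable_on U \<longleftrightarrow> h differentiable_on U"
    using Suc.prems by (metis (no_types, lifting) differentiable_on_def differentiable_transform_within zero_less_one)
  moreover have "C_k m U (partial k f) \<longleftrightarrow> C_k m U (partial k h)" for k
    by (rule Suc.IH) (use partial_cong[OF assms(1)] Suc.prems in blast)
  ultimately show ?case by simp
qed

lemma C_k_differentiable: "C_k (Suc m) U f \<Longrightarrow> f differentiable_on U"
  by simp

lemma C_k_Suc_imp: "C_k (Suc m) U f \<Longrightarrow> C_k m U f"
  by (induction m arbitrary: f) (auto simp: differentiable_imp_continuous_on)

lemma C_k_const: "C_k m U (\<lambda>y. c)"
proof (induction m arbitrary: c)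
  case (Suc m)
  have "partial k (\<lambda>y. c) = (\<lambda>y. 0)" for k :: 'a by auto
  then show ?case using Suc by simp
qed simp

lemma partial_add:
  assumes "(f has_derivative f') (at x)" "(h has_derivative h') (at x)"
  shows "partial k (\<lambda>y. f y + h y) x = partial k f x + partial k h x"
  using partial_eq[OF has_derivative_add[OF assms]] partial_eq[OF assms(1)] partial_eq[OF assms(2)] by simp

lemma partial_mult:
  assumes "(f has_derivative f') (at x)" "(h has_derivative h') (at x)"
  shows "partial k (\<lambda>y. f y * h y) x = f x * partial k h x + partial k f x * h x"
  using partial_eq[OF has_derivative_mult[OF assms]] partial_eq[OF assms(1)] partial_eq[OF assms(2)] by simp

lemma partial_inverse:
  fixes f :: "real^'n::finite \<Rightarrow> real"
  assumes "(f has_derivative f') (at x)" "f x \<noteq> 0"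
  shows "partial k (\<lambda>y. inverse (f y)) x = - (inverse (f x) * partial k f x * inverse (f x))"
  using partial_eq[OF Deriv.has_derivative_inverse[OF assms(2,1)]] partial_eq[OF assms(1)] by simp

lemma C_k_add:
  assumes "open U" "C_k m U f" "C_k m U h"
  shows "C_k m U (\<lambda>y. f y + h y)"
  using assms(2,3)
proof (induction m arbitrary: f h)
  case 0
  then show ?case by (auto intro: continuous_intros)
next
  case (Suc m)
  have "C_k m U (partial k (\<lambda>y. f y + h y))" for k
  proof -
    have "C_k m U (\<lambda>y. partial k f y + partial k h y)"
      using Suc by auto
    moreover have "partial k (\<lambda>y. f y + h y) y = partial k f y + partial k h y" if "y \<in> U" for y
      using partial_add[OF differentiable_onD differentiable_onD] that Suc.prems assms(1) C_k_differentiable by blast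
    ultimately show ?thesis by (simp cong: C_k_cong[OF assms(1)])
  qed
  then show ?case using Suc.prems by (auto intro: differentiable_on_add)
qed

lemma C_k_mult:
  assumes "open U" "C_k m U f" "C_k m U h"
  shows "C_k m U (\<lambda>y. f y * h y)"
  using assms(2,3)
proof (induction m arbitrary: f h)
  case 0
  then show ?case by (auto intro: continuous_intros)
next
  case (Suc m)
  have "C_k m U (partial k (\<lambda>y. f y * h y))" for k
  proof -
    \<comment> \<open>The product rule also contains the undifferentiated factors;
      \<open>C_k_Suc_imp\<close> lowers their class to \<open>m\<close>.\<close>
    have "C_k m U (\<lambda>y. f y * partial k h y + partial k f y * h y)"
      using Suc C_k_Suc_imp[OF Suc.prems(1)] C_k_Suc_imp[OF Suc.prems(2)] by (auto intro!: C_k_add[OF assms(1)])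
    moreover have "partial k (\<lambda>y. f y * h y) y = f y * partial k h y + partial k f y * h y" if "y \<in> U" for y
      using partial_mult[OF differentiable_onD differentiable_onD] that Suc.prems assms(1) C_k_differentiable by blast
    ultimately show ?thesis by (simp cong: C_k_cong[OF assms(1)])
  qed
  then show ?case using Suc.prems by (auto intro: differentiable_on_mult)
qed

text \<open>The derivative of \<open>inverse (f y)\<close> contains that function again, one order
  lower, so the induction on \<open>m\<close> keeps \<open>f\<close> fixed and closes with
  \<open>C_k_mult\<close>.\<close>

lemma C_k_inverse:
  assumes "open U" "C_k m U f" "\<And>y. y \<in> U \<Longrightarrow> f y \<noteq> 0"
  shows "C_k m U (\<lambda>y. inverse (f y))"
  using assms(2,3)
proof (induction m)
  case 0
  then show ?case by (auto intro: continuous_intros)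
next
  case (Suc m)
  have inv: "C_k m U (\<lambda>y. inverse (f y))"
    using Suc.IH Suc.prems C_k_Suc_imp by blast
  have "C_k m U (partial k (\<lambda>y. inverse (f y)))" for k
  proof -
    have "C_k m U (\<lambda>y. (- 1) * ((inverse (f y) * partial k f y) * inverse (f y)))"
      using Suc.prems(1) by (intro C_k_mult[OF assms(1)] C_k_const inv) auto
    moreover have "partial k (\<lambda>y. inverse (f y)) y = (- 1) * ((inverse (f y) * partial k f y) * inverse (f y))" if "y \<in> U" for y
      using partial_inverse[OF differentiable_onD[OF C_k_differentiable[OF Suc.prems(1)] assms(1) that]] Suc.prems(2)[OF that] by simp
    ultimately show ?thesis by (simp cong: C_k_cong[OF assms(1)])
  qed
  then show ?case using Suc.prems by (auto simp: differentiable_on_def intro: differentiable_inverse)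
qed

lemma smooth_partial: "smooth U f \<Longrightarrow> smooth U (partial k f)"
  unfolding smooth_def using C_k.simps(2) by blast

lemma smooth_differentiable: "smooth U f \<Longrightarrow> f differentiable_on U"
  unfolding smooth_def using C_k.simps(2) by blast

lemma smooth_continuous: "smooth U f \<Longrightarrow> continuous_on U f"
  unfolding smooth_def using C_k.simps(1) by blast

lemmas smooth_has_derivative = differentiable_onD[OF smooth_differentiable]

lemma smooth_cong:
  assumes "open U" "\<And>y. y \<in> U \<Longrightarrow> f y = h y"
  shows "smooth U f \<longleftrightarrow> smooth U h"
  unfolding smooth_def using C_k_cong[OF assms(1), of f h] assms(2) by blast

lemma smooth_const: "smooth U (\<lambda>y. c)"
  by (simp add: smooth_def C_k_const)

lemma smooth_add: "open U \<Longrightarrow> smooth U f \<Longrightarrow> smooth U h \<Longrightarrow> smooth U (\<lambda>y. f y + h y)"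
  by (simp add: smooth_def C_k_add)

lemma smooth_mult: "open U \<Longrightarrow> smooth U f \<Longrightarrow> smooth U h \<Longrightarrow> smooth U (\<lambda>y. f y * h y)"
  by (simp add: smooth_def C_k_mult)

lemma smooth_inverse:
  "open U \<Longrightarrow> smooth U f \<Longrightarrow> (\<And>y. y \<in> U \<Longrightarrow> f y \<noteq> 0) \<Longrightarrow> smooth U (\<lambda>y. inverse (f y))"
  by (simp add: smooth_def C_k_inverse)

lemma smooth_minus: "open U \<Longrightarrow> smooth U f \<Longrightarrow> smooth U (\<lambda>y. - f y)"
  using smooth_mult[OF _ smooth_const[of U "-1"], of f] by simp

lemma smooth_diff: "open U \<Longrightarrow> smooth U f \<Longrightarrow> smooth U h \<Longrightarrow> smooth U (\<lambda>y. f y - h y)"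
  using smooth_add[OF _ _ smooth_minus, of U f h] by simp

lemma smooth_divide:
  "open U \<Longrightarrow> smooth U f \<Longrightarrow> smooth U h \<Longrightarrow> (\<And>y. y \<in> U \<Longrightarrow> h y \<noteq> 0) \<Longrightarrow> smooth U (\<lambda>y. f y / h y)"
  by (simp add: divide_inverse smooth_mult smooth_inverse)

lemma smooth_sum:
  assumes "open U" "\<And>i. i \<in> I \<Longrightarrow> smooth U (f i)"
  shows "smooth U (\<lambda>y. \<Sum>i\<in>I. f i y)"
  using assms(2) by (induction I rule: infinite_finite_induct) (auto intro: smooth_const smooth_add[OF assms(1)])

lemma smooth_prod:
  assumes "open U" "\<And>i. i \<in> I \<Longrightarrow> smooth U (f i)"
  shows "smooth U (\<lambda>y. \<Prod>i\<in>I. f i y)"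
  using assms(2) by (induction I rule: infinite_finite_induct) (auto intro: smooth_const smooth_mult[OF assms(1)])

section \<open>Symmetry of second partial derivatives\<close>

lemma has_real_derivative_along_axis:
  fixes f :: "real^'n::finite \<Rightarrow> real"
  assumes "(f has_derivative f') (at (y + t *\<^sub>R axis k 1))"
  shows "((\<lambda>s. f (y + s *\<^sub>R axis k 1)) has_real_derivative partial k f (y + t *\<^sub>R axis k 1)) (at t)"
proof -
  have "((\<lambda>s. y + s *\<^sub>R axis k 1) has_derivative (\<lambda>s. s *\<^sub>R axis k (1::real))) (at t)"
    by (auto intro!: derivative_eq_intros)
  from has_derivative_compose[OF this assms]
  have "((\<lambda>s. f (y + s *\<^sub>R axis k 1)) has_derivative (\<lambda>s. f' (s *\<^sub>R axis k 1))) (at t)" .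
  moreover have "f' (s *\<^sub>R axis k 1) = f' (axis k 1) * s" for s
    using linear_scale[OF has_derivative_linear[OF assms]] by simp
  ultimately show ?thesis
    by (simp add: has_field_derivative_def partial_eq[OF assms])
qed

text \<open>Two applications of the mean value theorem: along axis \<open>i\<close> to the increment
  of \<open>f\<close> in direction \<open>j\<close>, then along axis \<open>j\<close> to
  \<open>partial i f\<close>.\<close>

lemma second_difference:
  fixes f :: "real^'n::finite \<Rightarrow> real"
  assumes U: "open U" "ball x d \<subseteq> U" and f: "f differentiable_on U" "partial i f differentiable_on U"
    and h: "0 < h" "2 * h < d"
  shows "\<exists>\<xi>\<in>ball x d. f (x + h *\<^sub>R axis i 1 + h *\<^sub>R axis j 1) - f (x + h *\<^sub>R axis i 1)
           - (f (x + h *\<^sub>R axis j 1) - f x) = h * (h * partial j (partial i f) \<xi>)"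
proof -
  \<comment> \<open>The points met below lie within \<open>2 * h\<close> of \<open>x\<close>, hence
    in the ball.\<close>
  have mem: "x + s *\<^sub>R axis i 1 + t *\<^sub>R axis j 1 \<in> ball x d" if "0 \<le> s" "s \<le> h" "0 \<le> t" "t \<le> h" for s t
  proof -
    have "norm (s *\<^sub>R axis i (1::real) + t *\<^sub>R axis j 1) \<le> \<bar>s\<bar> + \<bar>t\<bar>"
      by (rule order_trans[OF norm_triangle_ineq]) simp
    then have "dist x (x + s *\<^sub>R axis i 1 + t *\<^sub>R axis j 1) \<le> \<bar>s\<bar> + \<bar>t\<bar>"
      by (simp add: dist_norm flip: norm_minus_cancel[of "s *\<^sub>R _ + _"])
    then show ?thesis using that h by simp
  qed
  have Df: "(f has_derivative frechet_derivative f (at y)) (at y)" if "y \<in> ball x d" for y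
    using differentiable_onD[OF f(1) U(1)] that U by blast
  have Dp: "(partial i f has_derivative frechet_derivative (partial i f) (at y)) (at y)" if "y \<in> ball x d" for y
    using differentiable_onD[OF f(2) U(1)] that U by blast
  define \<phi> where "\<phi> s = f (x + h *\<^sub>R axis j 1 + s *\<^sub>R axis i 1) - f (x + s *\<^sub>R axis i 1)" for s
  have "DERIV \<phi> s :> partial i f (x + h *\<^sub>R axis j 1 + s *\<^sub>R axis i 1) - partial i f (x + s *\<^sub>R axis i 1)"
    if "0 \<le> s" "s \<le> h" for s
    unfolding \<phi>_def
    using mem[of s h] mem[of s 0] that h
    by (intro DERIV_diff[OF has_real_derivative_along_axis[OF Df] has_real_derivative_along_axis[OF Df]])
      (simp_all add: add_ac)
  from MVT2[OF h(1) this] obtain z where z: "0 < z" "z < h"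
    and z': "\<phi> h - \<phi> 0 = (h - 0) * (partial i f (x + h *\<^sub>R axis j 1 + z *\<^sub>R axis i 1) - partial i f (x + z *\<^sub>R axis i 1))"
    by blast
  have "DERIV (\<lambda>t. partial i f (x + z *\<^sub>R axis i 1 + t *\<^sub>R axis j 1)) t
      :> partial j (partial i f) (x + z *\<^sub>R axis i 1 + t *\<^sub>R axis j 1)" if "0 \<le> t" "t \<le> h" for t
    using mem[of z t] that z by (intro has_real_derivative_along_axis[OF Dp]) auto
  from MVT2[OF h(1) this] obtain w where w: "0 < w" "w < h"
    and w': "partial i f (x + z *\<^sub>R axis i 1 + h *\<^sub>R axis j 1) - partial i f (x + z *\<^sub>R axis i 1 + 0 *\<^sub>R axis j 1)
       = (h - 0) * partial j (partial i f) (x + z *\<^sub>R axis i 1 + w *\<^sub>R axis j 1)"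
    by blast
  show ?thesis
    using z' w' z w by (intro bexI[OF _ mem[of z w]]) (auto simp: \<phi>_def add_ac)
qed

text \<open>The second difference of \<open>f\<close> does not depend on the order of the axes. By
  \<open>second_difference\<close>, a value of one mixed derivative near \<open>x\<close> therefore
  equals a value of the other near \<open>x\<close>, and continuity excludes a gap at
  \<open>x\<close>.\<close>

lemma partial_commute:
  fixes f :: "real^'n::finite \<Rightarrow> real"
  assumes U: "open U" "x \<in> U" and f: "smooth U f"
  shows "partial i (partial j f) x = partial j (partial i f) x"
proof (rule ccontr)
  assume neq: "partial i (partial j f) x \<noteq> partial j (partial i f) x"
  \<comment> \<open>Half the gap: two numbers, each strictly within \<open>e\<close> of one of the
    two values at \<open>x\<close>, cannot coincide.\<close>
  define e where "e = \<bar>partial i (partial j f) x - partial j (partial i f) x\<bar> / 2"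
  have e: "e > 0" using neq by (simp add: e_def)
  have cont: "isCont (partial a (partial b f)) x" for a b
    using smooth_continuous[OF smooth_partial[OF smooth_partial[OF f]]] U continuous_on_eq_continuous_at by blast
  obtain d1 where d1: "d1 > 0" "\<And>y. dist y x < d1 \<Longrightarrow> \<bar>partial i (partial j f) y - partial i (partial j f) x\<bar> < e"
    using cont[of i j] e unfolding continuous_at dist_real_def Lim_at
    by (metis (no_types, lifting) abs_zero cancel_comm_monoid_add_class.diff_cancel dist_eq_0_iff zero_less_dist_iff)
  obtain d2 where d2: "d2 > 0" "\<And>y. dist y x < d2 \<Longrightarrow> \<bar>partial j (partial i f) y - partial j (partial i f) x\<bar> < e"
    using cont[of j i] e unfolding continuous_at dist_real_def Lim_at
    by (metis (no_types, lifting) abs_zero cancel_comm_monoid_add_class.diff_cancel dist_eq_0_iff zero_less_dist_iff)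
  obtain d3 where d3: "d3 > 0" "ball x d3 \<subseteq> U"
    using U open_contains_ball by blast
  define d where "d = min d1 (min d2 d3)"
  have d: "d > 0" "ball x d \<subseteq> U" using d1 d2 d3 by (auto simp: d_def)
  have h: "0 < d / 3" "2 * (d / 3) < d" using d by auto
  obtain \<xi> where \<xi>: "\<xi> \<in> ball x d" "f (x + (d/3) *\<^sub>R axis i 1 + (d/3) *\<^sub>R axis j 1) - f (x + (d/3) *\<^sub>R axis i 1)
           - (f (x + (d/3) *\<^sub>R axis j 1) - f x) = (d/3) * ((d/3) * partial j (partial i f) \<xi>)"
    using second_difference[OF U(1) d(2) _ _ h] f by (meson smooth_differentiable smooth_partial)
  obtain \<eta> where \<eta>: "\<eta> \<in> ball x d" "f (x + (d/3) *\<^sub>R axis j 1 + (d/3) *\<^sub>R axis i 1) - f (x + (d/3) *\<^sub>R axis j 1)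
           - (f (x + (d/3) *\<^sub>R axis i 1) - f x) = (d/3) * ((d/3) * partial i (partial j f) \<eta>)"
    using second_difference[OF U(1) d(2) _ _ h] f by (meson smooth_differentiable smooth_partial)
  have "f (x + (d/3) *\<^sub>R axis i 1 + (d/3) *\<^sub>R axis j 1) = f (x + (d/3) *\<^sub>R axis j 1 + (d/3) *\<^sub>R axis i 1)"
    by (simp add: add_ac)
  then have "(d/3) * ((d/3) * partial j (partial i f) \<xi>) = (d/3) * ((d/3) * partial i (partial j f) \<eta>)"
    using \<xi>(2) \<eta>(2) by linarith
  then have "partial j (partial i f) \<xi> = partial i (partial j f) \<eta>"
    using h by simp
  moreover have "\<bar>partial j (partial i f) \<xi> - partial j (partial i f) x\<bar> < e"
    using d2(2)[of \<xi>] \<xi>(1) by (simp add: d_def dist_commute)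
  moreover have "\<bar>partial i (partial j f) \<eta> - partial i (partial j f) x\<bar> < e"
    using d1(2)[of \<eta>] \<eta>(1) by (simp add: d_def dist_commute)
  ultimately show False
    unfolding e_def by (simp add: abs_if split: if_splits)
qed

section \<open>Matrix-valued functions\<close>

lemma matrix_inv_mult:
  fixes A :: "real^'n^'n"
  assumes "invertible A"
  shows "A ** matrix_inv A = mat 1" "matrix_inv A ** A = mat 1"
proof -
  have "A ** matrix_inv A = mat 1 \<and> matrix_inv A ** A = mat 1"
    unfolding matrix_inv_def using assms unfolding invertible_def by (rule someI_ex)
  then show "A ** matrix_inv A = mat 1" "matrix_inv A ** A = mat 1" by auto
qed

lemma matrix_mul_minus:
  fixes A B :: "real^'n^'n"
  shows "(- A) ** B = - (A ** B)" "A ** (- B) = - (A ** B)"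
  by (simp_all add: matrix_matrix_mult_def vec_eq_iff sum_negf)

lemma matrix_sub_distrib:
  fixes A B C :: "real^'n^'n"
  shows "(A - B) ** C = A ** C - B ** C" "A ** (B - C) = A ** B - A ** C"
  by (simp_all add: matrix_matrix_mult_def vec_eq_iff sum_subtractf algebra_simps)

lemma matrix_add_rdistrib:
  fixes A B C :: "real^'n^'n"
  shows "(A + B) ** C = A ** C + B ** C"
  by (simp add: matrix_matrix_mult_def vec_eq_iff sum.distrib algebra_simps)

lemma transpose_add: "transpose (A + B) = transpose A + transpose (B :: real^'n^'n)"
  by (simp add: transpose_def vec_eq_iff)

lemma transpose_sub: "transpose (A - B) = transpose A - transpose (B :: real^'n^'n)"
  by (simp add: transpose_def vec_eq_iff)

lemma transpose_minus: "transpose (- A) = - transpose (A :: real^'n^'n)"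
  by (simp add: transpose_def vec_eq_iff)

lemma matrix_mul_scaleR:
  fixes A B :: "real^'n^'n"
  shows "(c *\<^sub>R A) ** B = c *\<^sub>R (A ** B)" "A ** (c *\<^sub>R B) = c *\<^sub>R (A ** B)"
  by (simp_all add: scalar_matrix_assoc matrix_scalar_ac)

text \<open>As simplification rules these expand a matrix expression into a sum of left-nested
  products, leaving only additive cancellation.\<close>

lemmas matrix_ring =
  matrix_mul_assoc matrix_add_ldistrib matrix_add_rdistrib matrix_sub_distrib matrix_mul_minus
  transpose_add transpose_sub transpose_minus matrix_transpose_mul matrix_mul_scaleR

lemma trace_zero: "trace (0 :: real^'n^'n) = 0"
  by (simp add: trace_def)

lemma trace_transpose: "trace (transpose A) = trace (A :: real^'n^'n)"
  by (simp add: trace_def transpose_def)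

lemma trace_scaleR: "trace (c *\<^sub>R A) = c * trace (A :: real^'n^'n)"
  by (simp add: trace_def sum_distrib_left)

lemma trace_minus: "trace (- A) = - trace (A :: real^'n^'n)"
  by (simp add: trace_def sum_negf)

text \<open>Transposition and cyclicity of the trace turn this trace into its own negative.\<close>

lemma trace_sym_antisym:
  fixes S A :: "real^'n^'n"
  assumes "transpose S = S" "transpose A = - A"
  shows "trace (S ** A) = 0"
proof -
  have "trace (S ** A) = trace (transpose (S ** A))"
    by (simp only: trace_transpose)
  also have "\<dots> = - trace (S ** A)"
    by (simp add: matrix_transpose_mul assms matrix_mul_minus trace_minus trace_mul_sym[of A])
  finally show ?thesis by simp
qed

lemma partial_sum:
  assumes "finite I" "\<And>i. i \<in> I \<Longrightarrow> (f i has_derivative f' i) (at x)"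
  shows "partial k (\<lambda>y. \<Sum>i\<in>I. f i y) x = (\<Sum>i\<in>I. partial k (f i) x)"
  using partial_eq[OF has_derivative_sum, of I f f' x k] assms(2) by (simp add: partial_eq[OF assms(2)])

lemma partial_diff:
  assumes "(f has_derivative f') (at x)" "(h has_derivative h') (at x)"
  shows "partial k (\<lambda>y. f y - h y) x = partial k f x - partial k h x"
  using partial_eq[OF has_derivative_diff[OF assms]] partial_eq[OF assms(1)] partial_eq[OF assms(2)] by simp

section \<open>Entrywise smoothness and differentiation of matrix fields\<close>

definition msmooth :: "(real^'n::finite) set \<Rightarrow> (real^'n \<Rightarrow> real^'n^'n) \<Rightarrow> bool" where
  "msmooth U A \<longleftrightarrow> (\<forall>i j. smooth U (\<lambda>y. A y $ i $ j))"

definition mpartial :: "'n::finite \<Rightarrow> (real^'n \<Rightarrow> real^'n^'n) \<Rightarrow> real^'n \<Rightarrow> real^'n^'n" where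
  "mpartial k A x = (\<chi> i j. partial k (\<lambda>y. A y $ i $ j) x)"

lemma msmoothD: "msmooth U A \<Longrightarrow> smooth U (\<lambda>y. A y $ i $ j)"
  by (simp add: msmooth_def)

lemma msmooth_mpartial: "msmooth U A \<Longrightarrow> msmooth U (mpartial k A)"
  by (simp add: msmooth_def mpartial_def smooth_partial)

lemma msmooth_add: "open U \<Longrightarrow> msmooth U A \<Longrightarrow> msmooth U B \<Longrightarrow> msmooth U (\<lambda>y. A y + B y)"
  by (simp add: msmooth_def smooth_add)

lemma msmooth_diff: "open U \<Longrightarrow> msmooth U A \<Longrightarrow> msmooth U B \<Longrightarrow> msmooth U (\<lambda>y. A y - B y)"
  by (simp add: msmooth_def smooth_diff)

lemma msmooth_scaleR: "open U \<Longrightarrow> smooth U f \<Longrightarrow> msmooth U A \<Longrightarrow> msmooth U (\<lambda>y. f y *\<^sub>R A y)"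
  by (simp add: msmooth_def smooth_mult)

lemma msmooth_transpose: "msmooth U A \<Longrightarrow> msmooth U (\<lambda>y. transpose (A y))"
  by (simp add: msmooth_def transpose_def)

lemma msmooth_mult: "open U \<Longrightarrow> msmooth U A \<Longrightarrow> msmooth U B \<Longrightarrow> msmooth U (\<lambda>y. A y ** B y)"
  by (auto simp: msmooth_def matrix_matrix_mult_def intro!: smooth_sum smooth_mult)

lemma smooth_trace: "open U \<Longrightarrow> msmooth U A \<Longrightarrow> smooth U (\<lambda>y. trace (A y))"
  by (auto simp: msmooth_def trace_def intro!: smooth_sum)

lemma smooth_det:
  assumes "open U" "msmooth U A"
  shows "smooth U (\<lambda>y. det (A y))"
  unfolding det_def using assms(2)
  by (intro smooth_sum[OF assms(1)] smooth_mult[OF assms(1)] smooth_const smooth_prod[OF assms(1)])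
    (simp add: msmooth_def)

text \<open>Cramer's rule expresses the inverse rationally in the entries.\<close>

lemma msmooth_matrix_inv:
  assumes U: "open U" and A: "msmooth U A" and inv: "\<And>y. y \<in> U \<Longrightarrow> invertible (A y)"
  shows "msmooth U (\<lambda>y. matrix_inv (A y))"
  unfolding msmooth_def
proof (intro allI)
  fix k l
  let ?B = "\<lambda>y. \<chi> i j. if j = k then axis l 1 $ i else A y $ i $ j"
  have entry: "matrix_inv (A y) $ k $ l = det (?B y) / det (A y)" if "y \<in> U" for y
  proof -
    have "A y *v (matrix_inv (A y) *v axis l 1) = axis l 1"
      by (simp add: matrix_vector_mul_assoc matrix_inv_mult inv that)
    then have "matrix_inv (A y) *v axis l 1
        = (\<chi> k. det (\<chi> i j. if j = k then axis l 1 $ i else A y $ i $ j) / det (A y))"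
      using cramer[of "A y"] inv[OF that] by (simp add: invertible_det_nz)
    then have "(matrix_inv (A y) *v axis l 1) $ k = det (?B y) / det (A y)"
      by simp
    then show ?thesis by (simp add: matrix_vector_mul_component inner_axis)
  qed
  have "msmooth U ?B"
    unfolding msmooth_def
  proof (intro allI)
    fix i j show "smooth U (\<lambda>y. ?B y $ i $ j)"
      using A by (cases "j = k") (simp_all add: smooth_const msmooth_def)
  qed
  then have "smooth U (\<lambda>y. det (?B y) / det (A y))"
    using inv by (intro smooth_divide[OF U] smooth_det[OF U] A) (auto simp: invertible_det_nz)
  then show "smooth U (\<lambda>y. matrix_inv (A y) $ k $ l)"
    by (subst smooth_cong[OF U, of _ "\<lambda>y. det (?B y) / det (A y)"]) (rule entry, assumption+)
qed

lemma mpartial_cong: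
  assumes "open U" "x \<in> U" "\<And>y. y \<in> U \<Longrightarrow> A y = B y"
  shows "mpartial k A x = mpartial k B x"
proof -
  have "partial k (\<lambda>y. A y $ i $ j) x = partial k (\<lambda>y. B y $ i $ j) x" for i j
    by (rule partial_cong[OF assms(1,2)]) (simp add: assms(3))
  then show ?thesis by (simp add: mpartial_def)
qed

lemma mpartial_const [simp]: "mpartial k (\<lambda>y. C) x = 0"
  by (simp add: mpartial_def vec_eq_iff)

lemma mpartial_commute:
  assumes "open U" "x \<in> U" "msmooth U A"
  shows "mpartial j (mpartial k A) x = mpartial k (mpartial j A) x"
  using partial_commute[OF assms(1,2) msmoothD[OF assms(3)]] by (simp add: mpartial_def vec_eq_iff)

lemma mpartial_transpose: "mpartial k (\<lambda>y. transpose (A y)) x = transpose (mpartial k A x)"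
  by (simp add: mpartial_def transpose_def vec_eq_iff)

context
  fixes U :: "(real^'n::finite) set" and x
  assumes U: "open U" "x \<in> U"
begin

lemma mpartial_add:
  assumes "msmooth U A" "msmooth U B"
  shows "mpartial k (\<lambda>y. A y + B y) x = mpartial k A x + mpartial k B x"
  using partial_add[OF smooth_has_derivative[OF msmoothD U] smooth_has_derivative[OF msmoothD U]] assms
  by (simp add: mpartial_def vec_eq_iff)

lemma mpartial_diff:
  assumes "msmooth U A" "msmooth U B"
  shows "mpartial k (\<lambda>y. A y - B y) x = mpartial k A x - mpartial k B x"
  using partial_diff[OF smooth_has_derivative[OF msmoothD U] smooth_has_derivative[OF msmoothD U]] assms
  by (simp add: mpartial_def vec_eq_iff)

lemma mpartial_scaleR:
  assumes "smooth U f" "msmooth U A"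
  shows "mpartial k (\<lambda>y. f y *\<^sub>R A y) x = partial k f x *\<^sub>R A x + f x *\<^sub>R mpartial k A x"
  using partial_mult[OF smooth_has_derivative[OF assms(1) U] smooth_has_derivative[OF msmoothD U]] assms
  by (simp add: mpartial_def vec_eq_iff)

lemma mpartial_mult:
  assumes "msmooth U A" "msmooth U B"
  shows "mpartial k (\<lambda>y. A y ** B y) x = mpartial k A x ** B x + A x ** mpartial k B x"
proof -
  have "partial k (\<lambda>y. \<Sum>m\<in>UNIV. A y $ i $ m * B y $ m $ j) x
      = (\<Sum>m\<in>UNIV. partial k (\<lambda>y. A y $ i $ m * B y $ m $ j) x)" for i j
    by (intro partial_sum[OF _ smooth_has_derivative[OF _ U]] smooth_mult[OF U(1)] msmoothD assms) simp
  also have "\<dots> i j = (\<Sum>m\<in>UNIV. A x $ i $ m * partial k (\<lambda>y. B y $ m $ j) x + partial k (\<lambda>y. A y $ i $ m) x * B x $ m $ j)" for i j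
    by (intro sum.cong refl partial_mult[OF smooth_has_derivative[OF _ U] smooth_has_derivative[OF _ U]] msmoothD assms)
  finally show ?thesis
    by (simp add: mpartial_def matrix_matrix_mult_def vec_eq_iff sum.distrib add.commute)
qed

lemma partial_trace:
  assumes "msmooth U A"
  shows "partial k (\<lambda>y. trace (A y)) x = trace (mpartial k A x)"
  unfolding trace_def mpartial_def
  using partial_sum[OF _ smooth_has_derivative[OF msmoothD[OF assms] U], of UNIV k "\<lambda>i. i" "\<lambda>i. i"] by simp

text \<open>Differentiate \<open>A y ** matrix_inv (A y) = mat 1\<close> and multiply from the left
  by the inverse.\<close>

lemma mpartial_matrix_inv:
  assumes A: "msmooth U A" and inv: "\<And>y. y \<in> U \<Longrightarrow> invertible (A y)"
  shows "mpartial k (\<lambda>y. matrix_inv (A y)) x = - (matrix_inv (A x) ** mpartial k A x ** matrix_inv (A x))"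
proof -
  have "mpartial k (\<lambda>y. A y ** matrix_inv (A y)) x = mpartial k (\<lambda>y. mat 1) x"
    by (rule mpartial_cong[OF U]) (simp add: matrix_inv_mult inv)
  then have "mpartial k A x ** matrix_inv (A x) + A x ** mpartial k (\<lambda>y. matrix_inv (A y)) x = 0"
    using mpartial_mult[OF A msmooth_matrix_inv[OF U(1) A inv]] by simp
  then have "matrix_inv (A x) ** (mpartial k A x ** matrix_inv (A x)) +
      matrix_inv (A x) ** (A x ** mpartial k (\<lambda>y. matrix_inv (A y)) x) = 0"
    by (metis matrix_add_ldistrib times0_right)
  then show ?thesis
    by (simp add: matrix_mul_assoc matrix_inv_mult inv U eq_neg_iff_add_eq_0 add.commute)
qed

end

section \<open>Curvature of a metric in a chart\<close>

text \<open>One matrix per direction of differentiation \<open>k\<close>: contractions with the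
  connection become matrix products.\<close>

definition Gam :: "(real^'n \<Rightarrow> real^'n^'n) \<Rightarrow> 'n::finite \<Rightarrow> real^'n \<Rightarrow> real^'n^'n" where
  "Gam g k x = (\<chi> h i. christoffel g h i k x)"

definition cov :: "(real^'n \<Rightarrow> real^'n^'n) \<Rightarrow> 'n::finite \<Rightarrow> (real^'n \<Rightarrow> real^'n^'n) \<Rightarrow> real^'n \<Rightarrow> real^'n^'n" where
  "cov g k t x = mpartial k t x - transpose (Gam g k x) ** t x - t x ** Gam g k x"

lemma cov_deriv_02_eq: "cov_deriv_02 g t i j k x = cov g k t x $ i $ j"
  by (simp add: cov_deriv_02_def cov_def mpartial_def Gam_def matrix_matrix_mult_def transpose_def mult.commute)

definition Rm :: "(real^'n \<Rightarrow> real^'n^'n) \<Rightarrow> 'n::finite \<Rightarrow> 'n \<Rightarrow> real^'n \<Rightarrow> real^'n^'n" where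
  "Rm g j k x = mpartial j (Gam g k) x - mpartial k (Gam g j) x
     + Gam g j x ** Gam g k x - Gam g k x ** Gam g j x"

lemma riemann_eq: "riemann g h i j k x = Rm g j k x $ h $ i"
  by (simp add: riemann_def Rm_def mpartial_def Gam_def matrix_matrix_mult_def mult.commute)

lemma ricci_eq: "ricci g x $ i $ k = (\<Sum>h\<in>UNIV. Rm g h k x $ h $ i)"
  by (simp add: ricci_def riemann_eq)

lemma Rm_swap: "Rm g k j x = - Rm g j k x"
  by (simp add: Rm_def)

text \<open>The classical argument for the Riemann tensor: the cyclic identities with each of the
  four indices in front are combined linearly, and the antisymmetries cancel all but the two wanted
  terms.\<close>

lemma pair_symmetry:
  fixes r :: "'n \<Rightarrow> 'n \<Rightarrow> 'n \<Rightarrow> 'n \<Rightarrow> real"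
  assumes a: "\<And>h i j k. r h i j k = - r h i k j"
    and b: "\<And>h i j k. r h i j k = - r i h j k"
    and c: "\<And>h i j k. r h i j k + r h j k i + r h k i j = 0"
  shows "r h i j k = r j k h i"
  using c[of h i j k] c[of i j k h] c[of j k h i] c[of k h i j]
    a[of i k h j] a[of j h i k] b[of h i j k] b[of i j k h] b[of i j h k] b[of j k h i]
    b[of j k i h] b[of k h i j] b[of k i j h] b[of h j k i] a[of h j k i] a[of k i j h]
    a[of i j k h] a[of j k h i] a[of h k i j] a[of i h j k] a[of k h i j] b[of k h j i]
    b[of j h i k] b[of k i h j]
  by linarith

section \<open>The Levi-Civita connection: torsion-freeness and metric compatibility\<close>

locale metric_chart =
  fixes U :: "(real^'n::finite) set" and G :: "real^'n \<Rightarrow> real^'n^'n"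
  assumes open_U: "open U"
    and smooth_G: "msmooth U G"
    and sym_G: "x \<in> U \<Longrightarrow> transpose (G x) = G x"
    and inv_G: "x \<in> U \<Longrightarrow> invertible (G x)"
begin

abbreviation "Ginv \<equiv> \<lambda>x. matrix_inv (G x)"

lemmas ginv = matrix_inv_mult[OF inv_G]

lemma G_comm: "x \<in> U \<Longrightarrow> G x $ i $ j = G x $ j $ i"
  using sym_G[of x] by (simp add: transpose_def vec_eq_iff)

text \<open>Simplification nests products to the left, so cancellation is stated behind an arbitrary
  factor \<open>B\<close>.\<close>

lemma Ginv_cancel:
  assumes "x \<in> U"
  shows "B ** Ginv x ** G x = B" "B ** G x ** Ginv x = B"
  using ginv[OF assms] by (simp_all flip: matrix_mul_assoc)

lemma sym_Ginv:
  assumes "x \<in> U"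
  shows "transpose (Ginv x) = Ginv x"
proof -
  have "G x ** transpose (Ginv x) = mat 1"
    using arg_cong[OF ginv(2)[OF assms], of transpose] by (simp add: matrix_transpose_mul sym_G assms)
  then have "Ginv x ** G x ** transpose (Ginv x) = Ginv x"
    by (metis matrix_mul_assoc matrix_mul_rid)
  then show ?thesis by (simp add: ginv assms)
qed

lemma smooth_Ginv: "msmooth U Ginv"
  by (rule msmooth_matrix_inv[OF open_U smooth_G inv_G])

text \<open>Twice the Christoffel symbols of the first kind, \<open>m\<close> being the lowered
  index.\<close>

definition low :: "'n \<Rightarrow> real^'n \<Rightarrow> real^'n^'n" where
  "low k x = (\<chi> m i. partial i (\<lambda>y. G y $ m $ k) x + partial k (\<lambda>y. G y $ m $ i) x
           - partial m (\<lambda>y. G y $ i $ k) x)"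

lemma Gam_eq: "Gam G k x = (1/2) *\<^sub>R (Ginv x ** low k x)"
  by (simp add: Gam_def christoffel_def low_def matrix_matrix_mult_def vec_eq_iff)

lemma smooth_low: "msmooth U (low k)"
  unfolding msmooth_def low_def
  by (auto intro!: smooth_diff smooth_add open_U smooth_partial msmoothD[OF smooth_G])

lemma smooth_Gam: "msmooth U (Gam G k)"
proof -
  have "msmooth U (\<lambda>x. (1/2) *\<^sub>R (Ginv x ** low k x))"
    by (intro msmooth_scaleR msmooth_mult open_U smooth_const smooth_Ginv smooth_low)
  then show ?thesis by (simp add: Gam_eq[abs_def])
qed

lemma partial_G_comm: "x \<in> U \<Longrightarrow> partial k (\<lambda>y. G y $ i $ j) x = partial k (\<lambda>y. G y $ j $ i) x"
  by (rule partial_cong[OF open_U]) (simp_all add: G_comm)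

text \<open>Torsion-freeness: by symmetry of the metric, \<open>low\<close> is symmetric in the two
  indices other than \<open>m\<close>.\<close>

lemma Gam_comm:
  assumes "x \<in> U"
  shows "Gam G k x $ h $ i = Gam G i x $ h $ k"
proof -
  have "low k x $ m $ i = low i x $ m $ k" for m
    by (simp add: low_def partial_G_comm[OF assms, of m i k])
  then show ?thesis
    by (simp add: Gam_eq matrix_matrix_mult_def)
qed

text \<open>Metric compatibility. The first and third terms of \<open>low k x\<close> together are
  antisymmetric in \<open>m\<close>, \<open>i\<close>, so adding the transpose leaves twice the
  middle term.\<close>

lemma mpartial_G:
  assumes "x \<in> U"
  shows "mpartial k G x = transpose (Gam G k x) ** G x + G x ** Gam G k x"
proof -
  have *: "G x ** Gam G k x = (1/2) *\<^sub>R low k x"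
    by (simp add: Gam_eq matrix_ring ginv assms)
  have "transpose (Gam G k x) ** G x = transpose (G x ** Gam G k x)"
    by (simp add: matrix_transpose_mul sym_G assms)
  also have "\<dots> = (1/2) *\<^sub>R transpose (low k x)"
    by (simp only: * transpose_scalar)
  finally have "transpose (Gam G k x) ** G x + G x ** Gam G k x = (1/2) *\<^sub>R (transpose (low k x) + low k x)"
    by (simp add: * scaleR_add_right)
  also have "\<dots> = mpartial k G x"
    by (simp add: vec_eq_iff transpose_def low_def mpartial_def partial_G_comm[OF assms, of k])
  finally show ?thesis by simp
qed

lemma mpartial_Ginv:
  assumes "x \<in> U"
  shows "mpartial k Ginv x = - (Ginv x ** transpose (Gam G k x)) - Gam G k x ** Ginv x"
  by (simp add: mpartial_matrix_inv[OF open_U assms smooth_G inv_G] mpartial_G assms matrix_ring Ginv_cancel ginv)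

section \<open>Bianchi identities and symmetries of the curvature\<close>

lemma mpartial_Gam_comm:
  assumes "x \<in> U"
  shows "mpartial j (Gam G k) x $ h $ i = mpartial j (Gam G i) x $ h $ k"
  unfolding mpartial_def using partial_cong[OF open_U assms Gam_comm] by simp

text \<open>Torsion-freeness exchanges the free lower index with a form index in both the derivative
  and the product terms, so the cyclic sum cancels in pairs.\<close>

lemma first_bianchi:
  assumes "x \<in> U"
  shows "Rm G j k x $ h $ i + Rm G k i x $ h $ j + Rm G i j x $ h $ k = 0"
proof -
  have q: "(Gam G a x ** Gam G b x) $ h $ c = (Gam G a x ** Gam G c x) $ h $ b" for a b c
    by (simp add: matrix_matrix_mult_def Gam_comm[OF assms, of b _ c])
  show ?thesis
    unfolding Rm_def
    using q[of j k i] q[of k i j] q[of i j k] mpartial_Gam_comm[OF assms, of j k h i]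
      mpartial_Gam_comm[OF assms, of k i h j] mpartial_Gam_comm[OF assms, of i j h k]
    by simp
qed

lemma smooth_mpartial_Gam: "msmooth U (mpartial j (Gam G k))"
  by (rule msmooth_mpartial[OF smooth_Gam])

lemma smooth_Rm: "msmooth U (Rm G j k)"
proof -
  have "msmooth U (\<lambda>x. mpartial j (Gam G k) x - mpartial k (Gam G j) x
     + Gam G j x ** Gam G k x - Gam G k x ** Gam G j x)"
    by (intro msmooth_add msmooth_diff msmooth_mult open_U smooth_mpartial_Gam smooth_Gam)
  then show ?thesis by (simp add: Rm_def[abs_def])
qed

text \<open>
  No Christoffel terms occur for the form indices: they cancel in the cyclic sum.
\<close>

lemma second_bianchi:
  assumes x: "x \<in> U"
  shows "(mpartial l (Rm G j k) x + Gam G l x ** Rm G j k x - Rm G j k x ** Gam G l x)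
       + (mpartial j (Rm G k l) x + Gam G j x ** Rm G k l x - Rm G k l x ** Gam G j x)
       + (mpartial k (Rm G l j) x + Gam G k x ** Rm G l j x - Rm G l j x ** Gam G k x) = 0"
proof -
  have d: "mpartial l (Rm G j k) x = mpartial l (mpartial j (Gam G k)) x - mpartial l (mpartial k (Gam G j)) x
     + (mpartial l (Gam G j) x ** Gam G k x + Gam G j x ** mpartial l (Gam G k) x)
     - (mpartial l (Gam G k) x ** Gam G j x + Gam G k x ** mpartial l (Gam G j) x)" for l j k
  proof -
    have "mpartial l (Rm G j k) x = mpartial l (\<lambda>x. mpartial j (Gam G k) x - mpartial k (Gam G j) x
     + Gam G j x ** Gam G k x - Gam G k x ** Gam G j x) x"
      by (simp add: Rm_def[abs_def])
    also have "\<dots> = mpartial l (mpartial j (Gam G k)) x - mpartial l (mpartial k (Gam G j)) x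
     + (mpartial l (Gam G j) x ** Gam G k x + Gam G j x ** mpartial l (Gam G k) x)
     - (mpartial l (Gam G k) x ** Gam G j x + Gam G k x ** mpartial l (Gam G j) x)"
      by (simp add: mpartial_add[OF open_U x] mpartial_diff[OF open_U x] mpartial_mult[OF open_U x]
         smooth_Gam smooth_mpartial_Gam msmooth_add msmooth_diff msmooth_mult open_U)
    finally show ?thesis .
  qed
  note comm = mpartial_commute[OF open_U x smooth_Gam]
  show ?thesis
    unfolding d using comm[of l j k] comm[of l k j] comm[of j k l]
    by (simp add: Rm_def matrix_ring algebra_simps)
qed

text \<open>Integrability condition of \<open>mpartial_G\<close>, from the commuting second partials
  of \<open>G\<close>. It makes the lowered curvature antisymmetric in its first index pair.\<close>

lemma ricci_identity_G:
  assumes x: "x \<in> U"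
  shows "transpose (Rm G j k x) ** G x + G x ** Rm G j k x = 0"
proof -
  have d: "mpartial j (mpartial k G) x =
     (transpose (mpartial j (Gam G k) x) ** G x + transpose (Gam G k x) ** mpartial j G x)
     + (mpartial j G x ** Gam G k x + G x ** mpartial j (Gam G k) x)" for j k
  proof -
    have "mpartial j (mpartial k G) x = mpartial j (\<lambda>y. transpose (Gam G k y) ** G y + G y ** Gam G k y) x"
      by (rule mpartial_cong[OF open_U x mpartial_G])
    then show ?thesis
      by (simp add: mpartial_add[OF open_U x] mpartial_mult[OF open_U x] mpartial_transpose
         smooth_Gam smooth_G msmooth_mult msmooth_transpose open_U)
  qed
  show ?thesis
    using mpartial_commute[OF open_U x smooth_G, of j k]
    unfolding d by (simp add: Rm_def matrix_ring mpartial_G[OF x] algebra_simps)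
qed

text \<open>The trace pairs the skew matrix \<open>G x ** Rm G j k x\<close> with the symmetric
  \<open>Ginv x\<close>.\<close>

lemma Rm_trace:
  assumes x: "x \<in> U"
  shows "trace (Rm G j k x) = 0"
proof -
  have "transpose (G x ** Rm G j k x) = - (G x ** Rm G j k x)"
    using ricci_identity_G[OF x] by (simp add: matrix_transpose_mul sym_G x eq_neg_iff_add_eq_0)
  from trace_sym_antisym[OF sym_Ginv[OF x] this] show ?thesis
    by (simp add: matrix_mul_assoc ginv x)
qed

text \<open>Contract the first Bianchi identity; its middle term is the vanishing trace of the
  curvature.\<close>

lemma ricci_sym:
  assumes x: "x \<in> U"
  shows "transpose (ricci G x) = ricci G x"
proof -
  have "ricci G x $ k $ i = ricci G x $ i $ k" for i k
  proof -
    have "(\<Sum>h\<in>UNIV. Rm G h k x $ h $ i) + (\<Sum>h\<in>UNIV. Rm G k i x $ h $ h) + (\<Sum>h\<in>UNIV. Rm G i h x $ h $ k) = 0"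
      using first_bianchi[OF x] by (simp flip: sum.distrib)
    moreover have "(\<Sum>h\<in>UNIV. Rm G i h x $ h $ k) = - (\<Sum>h\<in>UNIV. Rm G h i x $ h $ k)"
      by (subst Rm_swap) (simp add: sum_negf)
    ultimately show ?thesis
      using Rm_trace[OF x, of k i] by (simp add: ricci_eq trace_def)
  qed
  then show ?thesis by (simp add: transpose_def vec_eq_iff)
qed

lemma Rm_low_pair_symmetry:
  assumes x: "x \<in> U"
  shows "(G x ** Rm G j k x) $ h $ i = (G x ** Rm G h i x) $ j $ k"
proof (rule pair_symmetry[of "\<lambda>h i j k. (G x ** Rm G j k x) $ h $ i"])
  fix h i j k
  show "(G x ** Rm G j k x) $ h $ i = - (G x ** Rm G k j x) $ h $ i"
    by (subst Rm_swap) (simp add: matrix_mul_minus)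
  have "transpose (G x ** Rm G j k x) = - (G x ** Rm G j k x)"
    using ricci_identity_G[OF x] by (simp add: matrix_transpose_mul sym_G x eq_neg_iff_add_eq_0)
  then have "transpose (G x ** Rm G j k x) $ i $ h = - (G x ** Rm G j k x) $ i $ h"
    by simp
  then show "(G x ** Rm G j k x) $ h $ i = - (G x ** Rm G j k x) $ i $ h"
    by (simp add: transpose_def)
  have "(G x ** Rm G j k x) $ h $ i + (G x ** Rm G k i x) $ h $ j + (G x ** Rm G i j x) $ h $ k
     = (\<Sum>m\<in>UNIV. G x $ h $ m * (Rm G j k x $ m $ i + Rm G k i x $ m $ j + Rm G i j x $ m $ k))"
    by (simp add: matrix_matrix_mult_def sum.distrib distrib_left)
  then show "(G x ** Rm G j k x) $ h $ i + (G x ** Rm G k i x) $ h $ j + (G x ** Rm G i j x) $ h $ k = 0"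
    by (simp add: first_bianchi[OF x])
qed

section \<open>Scalar curvature and energy-momentum tensor\<close>

lemma smooth_ricci: "msmooth U (ricci G)"
  unfolding msmooth_def ricci_eq
  by (auto intro!: smooth_sum open_U msmoothD smooth_Rm)

lemma scalar_curvature_eq:
  assumes "x \<in> U"
  shows "scalar_curvature G x = trace (Ginv x ** ricci G x)"
proof -
  have "scalar_curvature G x = trace (Ginv x ** transpose (ricci G x))"
    by (simp add: scalar_curvature_def trace_def matrix_matrix_mult_def transpose_def)
  then show ?thesis by (simp add: ricci_sym assms)
qed

lemma smooth_scalar_curvature: "smooth U (scalar_curvature G)"
proof -
  have "smooth U (\<lambda>x. trace (Ginv x ** ricci G x))"
    by (intro smooth_trace msmooth_mult open_U smooth_Ginv smooth_ricci)
  then show ?thesis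
    using smooth_cong[OF open_U, of "scalar_curvature G" "\<lambda>x. trace (Ginv x ** ricci G x)"] scalar_curvature_eq by blast
qed

text \<open>The inverse metric is parallel, so contraction with it commutes with covariant
  differentiation; the remaining connection terms cancel by cyclicity of the trace.\<close>

lemma partial_trace_Ginv:
  assumes x: "x \<in> U" and t: "msmooth U t"
  shows "partial k (\<lambda>y. trace (Ginv y ** t y)) x = trace (Ginv x ** cov G k t x)"
  using trace_mul_sym[of "Ginv x ** t x" "Gam G k x"]
  by (simp add: partial_trace[OF open_U x] msmooth_mult open_U smooth_Ginv t mpartial_mult[OF open_U x]
      mpartial_Ginv[OF x] cov_def matrix_ring trace_add trace_sub trace_minus)

lemma partial_scalar_curvature:
  assumes x: "x \<in> U"
  shows "partial k (scalar_curvature G) x = trace (Ginv x ** cov G k (ricci G) x)"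
  using partial_cong[OF open_U x scalar_curvature_eq] partial_trace_Ginv[OF x smooth_ricci] by simp

lemma energy_momentum_eq: "energy_momentum G x = ricci G x - ((1/2) * scalar_curvature G x) *\<^sub>R G x"
  by (simp add: energy_momentum_def vec_eq_iff)

text \<open>The metric is parallel, so only its scalar factor is differentiated.\<close>

lemma cov_energy_momentum:
  assumes x: "x \<in> U"
  shows "cov G k (energy_momentum G) x = cov G k (ricci G) x - (1/2 * partial k (scalar_curvature G) x) *\<^sub>R G x"
proof -
  have sm: "smooth U (\<lambda>y. (1/2) * scalar_curvature G y)"
    by (intro smooth_mult open_U smooth_const smooth_scalar_curvature)
  have "partial k (\<lambda>y. (1/2) * scalar_curvature G y) x = 1/2 * partial k (scalar_curvature G) x"
    using partial_mult[OF smooth_has_derivative[OF smooth_const open_U x] smooth_has_derivative[OF smooth_scalar_curvature open_U x], of k "1/2"]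
    by simp
  then have "mpartial k (energy_momentum G) x = mpartial k (ricci G) x
     - ((1/2 * partial k (scalar_curvature G) x) *\<^sub>R G x + (1/2 * scalar_curvature G x) *\<^sub>R mpartial k G x)"
    by (simp only: energy_momentum_eq[abs_def] mpartial_diff[OF open_U x smooth_ricci msmooth_scaleR[OF open_U sm smooth_G]]
         mpartial_scaleR[OF open_U x sm smooth_G])
  then show ?thesis
    by (simp add: cov_def energy_momentum_eq mpartial_G[OF x] matrix_ring algebra_simps)
qed

text \<open>The trace of \<open>Ginv x ** G x\<close> is the dimension, whence the factor, which
  vanishes only in dimension two.\<close>

lemma trace_cov_energy_momentum:
  assumes x: "x \<in> U"
  shows "trace (Ginv x ** cov G k (energy_momentum G) x) = (1 - CARD('n) / 2) * partial k (scalar_curvature G) x"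
  by (simp add: cov_energy_momentum[OF x] matrix_ring trace_sub trace_scaleR ginv x trace_I
      partial_scalar_curvature[OF x, symmetric] algebra_simps)

lemma smooth_energy_momentum: "msmooth U (energy_momentum G)"
proof -
  have "msmooth U (\<lambda>x. ricci G x - ((1/2) * scalar_curvature G x) *\<^sub>R G x)"
    by (intro msmooth_diff msmooth_scaleR smooth_mult open_U smooth_ricci smooth_const smooth_scalar_curvature smooth_G)
  then show ?thesis by (simp add: energy_momentum_eq[abs_def])
qed

lemma cov_transpose:
  "cov G k (\<lambda>y. transpose (t y)) x = transpose (cov G k t x)"
  by (simp add: cov_def mpartial_transpose matrix_ring)

lemma cov_cong:
  assumes "x \<in> U" "\<And>y. y \<in> U \<Longrightarrow> s y = t y"
  shows "cov G k s x = cov G k t x"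
  using mpartial_cong[OF open_U assms(1), of s t k] assms by (simp add: cov_def)

end

section \<open>Kaehler charts\<close>

locale kaehler_chart = metric_chart U G for U :: "(real^'n::finite) set" and G +
  fixes F :: "real^'n \<Rightarrow> real^'n^'n"
  assumes smooth_F: "msmooth U F"
    and F_square: "x \<in> U \<Longrightarrow> F x ** F x = - mat 1"
    and F_compat: "x \<in> U \<Longrightarrow> transpose (F x) ** G x = - (G x ** F x)"
    and F_parallel: "x \<in> U \<Longrightarrow> mpartial k F x = F x ** Gam G k x - Gam G k x ** F x"
begin

text \<open>\<open>transpose (F x) ** G x\<close> is, up to sign convention, the fundamental 2-form
  of the Kaehler structure.\<close>

lemma F_compat_transpose:
  assumes x: "x \<in> U"
  shows "transpose (transpose (F x) ** G x) = - (transpose (F x) ** G x)"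
  by (simp add: matrix_transpose_mul transpose_minus sym_G x F_compat)

text \<open>Compatibility multiplied on both sides by the inverse metric.
  \<open>F x ** Ginv x\<close> is the bivector inverse to the fundamental form.\<close>

lemma F_Ginv:
  assumes x: "x \<in> U"
  shows "transpose (F x ** Ginv x) = - (F x ** Ginv x)"
proof -
  have "Ginv x ** (transpose (F x) ** G x) ** Ginv x = - (Ginv x ** (G x ** F x) ** Ginv x)"
    by (simp only: F_compat[OF x] matrix_mul_minus)
  then show ?thesis
    by (simp add: matrix_ring Ginv_cancel ginv x sym_Ginv)
qed

text \<open>Integrability condition of \<open>F_parallel\<close>, from the commuting second partials
  of \<open>F\<close>.\<close>

lemma ricci_identity_F:
  assumes x: "x \<in> U"
  shows "F x ** Rm G j k x = Rm G j k x ** F x"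
proof -
  have d: "mpartial j (mpartial k F) x =
     (mpartial j F x ** Gam G k x + F x ** mpartial j (Gam G k) x)
      - (mpartial j (Gam G k) x ** F x + Gam G k x ** mpartial j F x)" for j k
  proof -
    have "mpartial j (mpartial k F) x = mpartial j (\<lambda>y. F y ** Gam G k y - Gam G k y ** F y) x"
      by (rule mpartial_cong[OF open_U x F_parallel])
    then show ?thesis
      by (simp add: mpartial_diff[OF open_U x] mpartial_mult[OF open_U x]
         smooth_Gam smooth_F msmooth_mult open_U)
  qed
  show ?thesis
    using mpartial_commute[OF open_U x smooth_F, of j k]
    unfolding d by (simp add: Rm_def matrix_ring F_parallel[OF x] algebra_simps)
qed

section \<open>The Ricci form: skewness and closedness\<close>

definition \<omega> :: "real^'n \<Rightarrow> real^'n^'n" where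
  "\<omega> x = transpose (F x) ** ricci G x"

text \<open>Commuting with the curvature moves \<open>F\<close> from a lower index to the contracted
  upper one, where it can meet the inverse metric.\<close>

lemma \<omega>_eq:
  assumes x: "x \<in> U"
  shows "\<omega> x $ j $ k = (\<Sum>i\<in>UNIV. (F x ** Rm G i k x) $ i $ j)"
proof -
  have "\<omega> x $ j $ k = (\<Sum>i\<in>UNIV. (Rm G i k x ** F x) $ i $ j)"
    unfolding \<omega>_def matrix_matrix_mult_def transpose_def
    by (simp add: ricci_eq sum_distrib_left mult.commute) (rule sum.swap)
  then show ?thesis by (simp add: ricci_identity_F[OF x])
qed

text \<open>With the curvature lowered, the Ricci form is a contraction with the skew bivector
  \<open>?H\<close>; by pair symmetry, exchanging \<open>j\<close> and \<open>k\<close> amounts to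
  exchanging the indices of \<open>?H\<close>.\<close>

lemma \<omega>_antisym:
  assumes x: "x \<in> U"
  shows "transpose (\<omega> x) = - \<omega> x"
proof -
  let ?H = "F x ** Ginv x"
  let ?R = "\<lambda>h i j k. (G x ** Rm G j k x) $ h $ i"
  have H: "?H $ h $ i = - ?H $ i $ h" for h i
    using arg_cong[OF F_Ginv[OF x], of "\<lambda>A. A $ i $ h"] by (simp add: transpose_def)
  have w: "\<omega> x $ j $ k = (\<Sum>i\<in>UNIV. \<Sum>h\<in>UNIV. ?H $ i $ h * ?R h j i k)" for j k
  proof -
    have "F x ** Rm G i k x = ?H ** (G x ** Rm G i k x)" for i
      by (simp add: matrix_mul_assoc Ginv_cancel x)
    then show ?thesis
      unfolding \<omega>_eq[OF x] by (simp add: matrix_matrix_mult_def[of ?H])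
  qed
  have "transpose (\<omega> x) $ j $ k = (- \<omega> x) $ j $ k" for j k
  proof -
    have "\<omega> x $ k $ j = (\<Sum>i\<in>UNIV. \<Sum>h\<in>UNIV. - (?H $ h $ i * ?R i j h k))"
      unfolding w using H Rm_low_pair_symmetry[OF x] by (intro sum.cong refl) (metis mult_minus_left)
    also have "\<dots> = - \<omega> x $ j $ k"
      unfolding w by (subst sum.swap) (simp add: sum_negf)
    finally show ?thesis by (simp add: transpose_def)
  qed
  then show ?thesis by (simp add: vec_eq_iff)
qed

text \<open>The first Bianchi identity splits the trace into the Ricci form at \<open>j\<close>,
  \<open>k\<close> minus that at \<open>k\<close>, \<open>j\<close>; skewness turns the difference
  into a double.\<close>

lemma trace_F_Rm:
  assumes x: "x \<in> U"
  shows "trace (F x ** Rm G j k x) = 2 * \<omega> x $ j $ k"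
proof -
  have R: "Rm G j k x $ h $ i = Rm G i k x $ h $ j - Rm G i j x $ h $ k" for h i
    using first_bianchi[OF x, of j k h i] arg_cong[OF Rm_swap[of G i k x], of "\<lambda>A. A $ h $ j"] by simp
  have "trace (F x ** Rm G j k x) = \<omega> x $ j $ k - \<omega> x $ k $ j"
    unfolding \<omega>_eq[OF x] trace_def matrix_matrix_mult_def
    by (simp add: R right_diff_distrib sum_subtractf)
  moreover have "\<omega> x $ k $ j = - \<omega> x $ j $ k"
    using arg_cong[OF \<omega>_antisym[OF x], of "\<lambda>A. A $ j $ k"] by (simp add: transpose_def)
  ultimately show ?thesis by simp
qed

lemma smooth_\<omega>: "msmooth U \<omega>"
  unfolding \<omega>_def[abs_def] by (intro msmooth_mult open_U msmooth_transpose smooth_F smooth_ricci)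

text \<open>Differentiate \<open>trace_F_Rm\<close>. As \<open>F\<close> is parallel, the derivative
  falls on the curvature, as the expression that \<open>second_bianchi\<close> sums
  cyclically.\<close>

lemma mpartial_\<omega>:
  assumes x: "x \<in> U"
  shows "2 * mpartial l \<omega> x $ j $ k
    = trace (F x ** (mpartial l (Rm G j k) x + Gam G l x ** Rm G j k x - Rm G j k x ** Gam G l x))"
proof -
  have "partial l (\<lambda>y. trace (F y ** Rm G j k y)) x = partial l (\<lambda>y. 2 * \<omega> y $ j $ k) x"
    by (rule partial_cong[OF open_U x trace_F_Rm])
  also have "\<dots> = 2 * mpartial l \<omega> x $ j $ k"
    using partial_mult[OF smooth_has_derivative[OF smooth_const open_U x]
        smooth_has_derivative[OF msmoothD[OF smooth_\<omega>] open_U x], of l 2]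
    by (simp add: mpartial_def)
  finally show ?thesis
    using trace_mul_sym[of "F x ** Rm G j k x" "Gam G l x"]
    by (simp add: partial_trace[OF open_U x] mpartial_mult[OF open_U x] smooth_F smooth_Rm msmooth_mult open_U
        F_parallel[OF x] matrix_ring trace_add trace_sub)
qed

text \<open>Multiply the second Bianchi identity by \<open>F\<close> and take the trace.\<close>

lemma \<omega>_closed:
  assumes x: "x \<in> U"
  shows "mpartial l \<omega> x $ j $ k + mpartial j \<omega> x $ k $ l + mpartial k \<omega> x $ l $ j = 0"
  using mpartial_\<omega>[OF x, of l j k] mpartial_\<omega>[OF x, of j k l] mpartial_\<omega>[OF x, of k l j]
    arg_cong[OF second_bianchi[OF x, of l j k], of "\<lambda>A. trace (F x ** A)"]
  by (simp add: matrix_ring trace_add trace_sub trace_zero)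

text \<open>For a 2-form, the terms of a torsion-free connection cancel in the cyclic sum, so
  closedness passes to covariant derivatives.\<close>

lemma cov_\<omega>_cyclic:
  assumes x: "x \<in> U"
  shows "cov G l \<omega> x $ j $ k + cov G j \<omega> x $ k $ l + cov G k \<omega> x $ l $ j = 0"
proof -
  have q: "(\<omega> x ** Gam G k x) $ j $ l = (\<omega> x ** Gam G l x) $ j $ k" for j k l
    by (simp add: matrix_matrix_mult_def Gam_comm[OF x, of k])
  have t: "(transpose (Gam G l x) ** \<omega> x) $ j $ k = - (\<omega> x ** Gam G l x) $ k $ j" for l j k
  proof -
    have "transpose (Gam G l x) ** \<omega> x = - transpose (\<omega> x ** Gam G l x)"
      by (simp add: matrix_transpose_mul \<omega>_antisym[OF x] matrix_mul_minus)
    then show ?thesis by (simp add: transpose_def)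
  qed
  show ?thesis
    using \<omega>_closed[OF x, of l j k] q[of j k l] q[of k l j] q[of l j k]
    by (simp add: cov_def t)
qed

lemma cov_transpose_F_mult:
  assumes x: "x \<in> U" and t: "msmooth U t"
  shows "cov G k (\<lambda>y. transpose (F y) ** t y) x = transpose (F x) ** cov G k t x"
  by (simp add: cov_def mpartial_mult[OF open_U x] msmooth_transpose smooth_F t mpartial_transpose
      F_parallel[OF x] matrix_ring)

lemma cov_\<omega>:
  assumes x: "x \<in> U"
  shows "cov G k \<omega> x = transpose (F x) ** cov G k (ricci G) x"
  unfolding \<omega>_def[abs_def] by (rule cov_transpose_F_mult[OF x smooth_ricci])

text \<open>\<open>?W\<close> is the Ricci form minus a multiple of the fundamental form, both skew;
  covariant differentiation commutes with \<open>transpose\<close> and with the parallel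
  \<open>F\<close>.\<close>

lemma cov_energy_momentum_hybrid:
  assumes x: "x \<in> U"
  shows "transpose (transpose (F x) ** cov G k (energy_momentum G) x)
    = - (transpose (F x) ** cov G k (energy_momentum G) x)"
proof -
  let ?W = "\<lambda>y. transpose (F y) ** energy_momentum G y"
  have "transpose (?W y) = - ?W y" if "y \<in> U" for y
    using \<omega>_antisym[OF that] F_compat_transpose[OF that]
    by (simp add: \<omega>_def energy_momentum_eq matrix_sub_distrib matrix_mul_scaleR transpose_sub transpose_scalar)
  then have "cov G k (\<lambda>y. transpose (?W y)) x = cov G k (\<lambda>y. - ?W y) x"
    by (rule cov_cong[OF x])
  moreover have "mpartial k (\<lambda>y. - ?W y) x = - mpartial k ?W x"
    using mpartial_diff[OF open_U x, of "\<lambda>y. 0" ?W k]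
    by (simp add: msmooth_def[of U "\<lambda>y. 0"] smooth_const msmooth_mult msmooth_transpose open_U smooth_F smooth_energy_momentum)
  then have "cov G k (\<lambda>y. - ?W y) x = - cov G k ?W x"
    by (simp add: cov_def matrix_ring)
  ultimately show ?thesis
    by (simp add: cov_transpose cov_transpose_F_mult[OF x smooth_energy_momentum])
qed

end

section \<open>Parallelism of the energy-momentum tensor\<close>

text \<open>Alternating the two swaps six times restores the index order after three sign
  changes.\<close>

lemma sym_antisym_vanish:
  fixes A :: "'n \<Rightarrow> 'n \<Rightarrow> 'n \<Rightarrow> real"
  assumes "\<And>i j k. A i j k = - A j i k" "\<And>i j k. A i j k = A i k j"
  shows "A i j k = 0"
  using assms(1)[of i j k] assms(2)[of j i k] assms(1)[of j k i] assms(2)[of k j i]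
    assms(1)[of k i j] assms(2)[of i k j] by linarith

text \<open>The cyclic hypothesis says that the exterior product of \<open>c\<close> with the
  nondegenerate 2-form \<open>W\<close> vanishes; contraction with the inverse \<open>E\<close>
  leaves \<open>n - 2\<close> times \<open>c\<close>.\<close>

lemma antisym_cyclic_vanish:
  fixes W E :: "real^'n^'n" and c :: "'n \<Rightarrow> real"
  assumes WE: "W ** E = mat 1" and W: "transpose W = - W" and E: "transpose E = - E"
    and n: "CARD('n) > 2"
    and cyc: "\<And>l j k. c l * W $ j $ k + c j * W $ k $ l + c k * W $ l $ j = 0"
  shows "c l = 0"
proof -
  have Wa: "W $ k $ j = - W $ j $ k" for j k
    using arg_cong[OF W, of "\<lambda>A. A $ j $ k"] by (simp add: transpose_def)
  have Ea: "E $ k $ j = - E $ j $ k" for j k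
    using arg_cong[OF E, of "\<lambda>A. A $ j $ k"] by (simp add: transpose_def)
  have delta: "(\<Sum>k\<in>UNIV. W $ i $ k * E $ k $ j) = (if i = j then 1 else 0)" for i j
    using arg_cong[OF WE, of "\<lambda>A. A $ i $ j"] by (simp add: matrix_matrix_mult_def mat_def)
  have "0 = (\<Sum>j\<in>UNIV. \<Sum>k\<in>UNIV. (c l * W $ j $ k + c j * W $ k $ l + c k * W $ l $ j) * E $ k $ j)"
    by (simp add: cyc)
  also have "\<dots> = (\<Sum>j\<in>UNIV. \<Sum>k\<in>UNIV. c l * (W $ j $ k * E $ k $ j))
     + (\<Sum>j\<in>UNIV. \<Sum>k\<in>UNIV. c j * (W $ k $ l * E $ k $ j))
     + (\<Sum>j\<in>UNIV. \<Sum>k\<in>UNIV. c k * (W $ l $ j * E $ k $ j))"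
    by (simp add: distrib_right sum.distrib mult.assoc)
  \<comment> \<open>The first sum is the trace of \<open>W ** E\<close>. Each of the other two gives
    \<open>- c l\<close>, once skewness of \<open>W\<close> or \<open>E\<close> restores the index
    order of \<open>delta\<close>.\<close>
  also have "(\<Sum>j\<in>UNIV. \<Sum>k\<in>UNIV. c l * (W $ j $ k * E $ k $ j)) = CARD('n) * c l"
    by (simp add: delta flip: sum_distrib_left)
  also have "(\<Sum>j\<in>UNIV. \<Sum>k\<in>UNIV. c j * (W $ k $ l * E $ k $ j)) = - (\<Sum>j\<in>UNIV. c j * (\<Sum>k\<in>UNIV. W $ l $ k * E $ k $ j))"
    by (simp add: Wa[of _ l] sum_negf sum_distrib_left)
  also have "\<dots> = - c l"
    by (simp add: delta if_distrib cong: if_cong)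
  also have "(\<Sum>j\<in>UNIV. \<Sum>k\<in>UNIV. c k * (W $ l $ j * E $ k $ j)) = - (\<Sum>k\<in>UNIV. c k * (\<Sum>j\<in>UNIV. W $ l $ j * E $ j $ k))"
  proof -
    have "c k * (W $ l $ j * E $ k $ j) = - (c k * (W $ l $ j * E $ j $ k))" for k j
      by (subst Ea) simp
    then show ?thesis
      by (subst sum.swap) (simp add: sum_negf sum_distrib_left)
  qed
  also have "\<dots> = - c l"
    by (simp add: delta if_distrib cong: if_cong)
  finally show ?thesis using n by (simp add: algebra_simps)
qed

section \<open>The two conditions in a single chart\<close>

context kaehler_chart
begin

lemma F_transpose_square: "x \<in> U \<Longrightarrow> transpose (F x) ** transpose (F x) = - mat 1"
  using arg_cong[OF F_square, of x transpose] by (simp add: matrix_transpose_mul transpose_minus)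

lemma ricci_parallel:
  assumes x: "x \<in> U" and n: "CARD('n) > 2" and "\<And>k. cov G k (energy_momentum G) x = 0"
  shows "cov G k (ricci G) x = 0"
proof -
  have "(1 - CARD('n) / 2) * partial k (scalar_curvature G) x = 0"
    using trace_cov_energy_momentum[OF x, of k] by (simp add: assms(3) trace_zero)
  \<comment> \<open>The factor is nonzero because the dimension exceeds two.\<close>
  then have "partial k (scalar_curvature G) x = 0"
    using n by auto
  then show ?thesis
    using cov_energy_momentum[OF x, of k] assms(3) by simp
qed

lemma codazzi_vanish:
  assumes x: "x \<in> U"
    and cod: "\<And>i j k. cov G k (energy_momentum G) x $ i $ j = cov G j (energy_momentum G) x $ i $ k"
  shows "cov G k (energy_momentum G) x = 0"
proof -
  let ?S = "\<lambda>k. cov G k (energy_momentum G) x"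
  have "(transpose (F x) ** ?S k) $ i $ j = 0" for i j
  proof (rule sym_antisym_vanish[of "\<lambda>i j k. (transpose (F x) ** ?S k) $ i $ j"])
    fix i j k
    show "(transpose (F x) ** ?S k) $ i $ j = - (transpose (F x) ** ?S k) $ j $ i"
      using arg_cong[OF cov_energy_momentum_hybrid[OF x, of k], of "\<lambda>A. A $ j $ i"]
      by (simp add: transpose_def)
    \<comment> \<open>\<open>F\<close> acts on the first index only, so the Codazzi symmetry in
      \<open>j\<close>, \<open>k\<close> survives.\<close>
    show "(transpose (F x) ** ?S k) $ i $ j = (transpose (F x) ** ?S j) $ i $ k"
      unfolding matrix_matrix_mult_def by (simp add: cod[of k _ j])
  qed
  then have "transpose (F x) ** ?S k = 0"
    by (simp add: vec_eq_iff)
  \<comment> \<open>\<open>transpose (F x)\<close> squares to minus the identity and can be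
    cancelled.\<close>
  then have "(transpose (F x) ** transpose (F x)) ** ?S k = 0"
    by (simp flip: matrix_mul_assoc)
  then show ?thesis
    by (simp add: F_transpose_square[OF x] matrix_mul_minus)
qed

lemma omega3_b_vanish:
  fixes a b :: "real^'n"
  assumes x: "x \<in> U"
    and S: "\<And>i j k. cov G k (energy_momentum G) x $ i $ j
              = a $ k * G x $ i $ j + b $ i * G x $ j $ k + b $ j * G x $ i $ k"
  shows "b = 0"
proof -
  let ?S = "\<lambda>k. cov G k (energy_momentum G) x"
  let ?W = "transpose (F x) ** G x"
  define \<beta> where "\<beta> = transpose (F x) *v b"
  have W: "?W $ i $ j = - ?W $ j $ i" for i j
    using arg_cong[OF F_compat_transpose[OF x], of "\<lambda>A. A $ j $ i"] by (simp add: transpose_def)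
  have FS: "(transpose (F x) ** ?S k) $ i $ j = a $ k * ?W $ i $ j + \<beta> $ i * G x $ j $ k + b $ j * ?W $ i $ k" for i j k
    by (simp add: matrix_matrix_mult_def S \<beta>_def matrix_vector_mult_def sum.distrib sum_distrib_left
        sum_distrib_right algebra_simps)
  \<comment> \<open>The term with \<open>a\<close> drops out of the antisymmetry condition because
    \<open>?W\<close> is skew.\<close>
  have zero: "\<beta> $ i * G x $ j $ k + b $ j * ?W $ i $ k + \<beta> $ j * G x $ i $ k + b $ i * ?W $ j $ k = 0" for i j k
    using arg_cong[OF cov_energy_momentum_hybrid[OF x, of k], of "\<lambda>A. A $ i $ j"] W[of i j]
    by (simp add: transpose_def[of "_ ** ?S k"] FS algebra_simps)
  have \<beta>: "\<beta> $ i = 0" for i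
  proof -
    \<comment> \<open>Contraction with the inverse metric: the four terms give \<open>n\<close>, 1,
      1 and 0 times \<open>\<beta> $ i\<close>, the last because \<open>F\<close> is
      trace-free.\<close>
    have "0 = (\<Sum>j\<in>UNIV. \<Sum>k\<in>UNIV. (\<beta> $ i * G x $ j $ k + b $ j * ?W $ i $ k + \<beta> $ j * G x $ i $ k
        + b $ i * ?W $ j $ k) * Ginv x $ k $ j)"
      by (simp add: zero)
    also have "\<dots> = \<beta> $ i * trace (G x ** Ginv x) + (\<Sum>j\<in>UNIV. b $ j * (?W ** Ginv x) $ i $ j)
        + (\<Sum>j\<in>UNIV. \<beta> $ j * (G x ** Ginv x) $ i $ j) + b $ i * trace (?W ** Ginv x)"
      by (simp add: trace_def matrix_matrix_mult_def[of _ "Ginv x"] distrib_right sum.distrib sum_distrib_left mult.assoc)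
    also have "?W ** Ginv x = transpose (F x)"
      by (simp add: Ginv_cancel x)
    also have "trace (transpose (F x)) = 0"
      using trace_sym_antisym[OF sym_Ginv[OF x] F_compat_transpose[OF x]] trace_mul_sym[of "Ginv x" ?W]
      by (simp add: Ginv_cancel x)
    also have "(\<Sum>j\<in>UNIV. b $ j * transpose (F x) $ i $ j) = \<beta> $ i"
      by (simp add: \<beta>_def matrix_vector_mult_def mult.commute)
    also have "(\<Sum>j\<in>UNIV. \<beta> $ j * (G x ** Ginv x) $ i $ j) = \<beta> $ i"
      by (simp add: ginv x mat_def if_distrib cong: if_cong)
    also have "trace (G x ** Ginv x) = CARD('n)"
      by (simp add: ginv x trace_I)
    finally have "(real CARD('n) + 2) * \<beta> $ i = 0"
      by (simp add: algebra_simps)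
    then show ?thesis
      by (metis add_pos_pos less_irrefl mult_eq_0_iff of_nat_0_less_iff zero_less_card_finite zero_less_numeral)
  qed
  have "- b = (transpose (F x) ** transpose (F x)) *v b"
    by (simp add: F_transpose_square[OF x] matrix_vector_mult_def mat_def vec_eq_iff if_distrib if_distribR
        cong: if_cong)
  also have "\<dots> = transpose (F x) *v \<beta>"
    by (simp only: \<beta>_def matrix_vector_mul_assoc)
  also have "\<beta> = 0"
    using \<beta> by (simp add: vec_eq_iff)
  finally show ?thesis by simp
qed

lemma omega3_vanish:
  fixes a b :: "real^'n"
  assumes x: "x \<in> U" and n: "CARD('n) > 2"
    and S: "\<And>i j k. cov G k (energy_momentum G) x $ i $ j
              = a $ k * G x $ i $ j + b $ i * G x $ j $ k + b $ j * G x $ i $ k"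
  shows "cov G k (energy_momentum G) x = 0"
proof -
  have "b = 0" by (rule omega3_b_vanish[OF x S])
  then have Sk: "cov G k (energy_momentum G) x = a $ k *\<^sub>R G x" for k
    by (simp add: vec_eq_iff S)
  \<comment> \<open>The factor of the metric in the derivative of the Ricci tensor: passing from the
    energy-momentum tensor adds half the derivative of the scalar curvature.\<close>
  define c where "c k = a $ k + 1/2 * partial k (scalar_curvature G) x" for k
  have R: "cov G k (ricci G) x = c k *\<^sub>R G x" for k
    using cov_energy_momentum[OF x, of k] by (simp add: Sk c_def scaleR_add_left algebra_simps)
  have w: "cov G k \<omega> x = c k *\<^sub>R (transpose (F x) ** G x)" for k
    by (simp add: cov_\<omega>[OF x] R matrix_mul_scaleR)
  have c0: "c k = 0" for k
  \<comment> \<open>Closedness of the Ricci form makes the exterior product of \<open>c\<close> with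
    the fundamental form vanish; \<open>F x ** Ginv x\<close> serves as the inverse.\<close>
  proof (rule antisym_cyclic_vanish[OF _ F_compat_transpose[OF x] F_Ginv[OF x] n])
    have "Ginv x ** transpose (F x) = - (F x ** Ginv x)"
      using F_Ginv[OF x] by (simp add: matrix_transpose_mul sym_Ginv x)
    then have "transpose (F x) ** G x ** (F x ** Ginv x) = - (transpose (F x) ** G x ** (Ginv x ** transpose (F x)))"
      by (simp add: matrix_mul_minus)
    also have "\<dots> = mat 1"
      by (simp add: matrix_mul_assoc Ginv_cancel x F_transpose_square)
    finally show "transpose (F x) ** G x ** (F x ** Ginv x) = mat 1" .
    show "c l * (transpose (F x) ** G x) $ j $ k + c j * (transpose (F x) ** G x) $ k $ l
      + c k * (transpose (F x) ** G x) $ l $ j = 0" for l j k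
      using cov_\<omega>_cyclic[OF x, of l j k] by (simp add: w)
  qed
  \<comment> \<open>With \<open>c\<close> zero the Ricci tensor is parallel at \<open>x\<close>, so
    the scalar curvature has zero derivative there, and the energy-momentum tensor is parallel
    too.\<close>
  then have "partial k (scalar_curvature G) x = 0" for k
    by (simp add: partial_scalar_curvature[OF x] R trace_zero)
  then show ?thesis
    using cov_energy_momentum[OF x, of k] by (simp add: R c0)
qed

end

section \<open>From the Kaehler space to its charts and back\<close>

lemma kaehler_space_chart:
  assumes "kaehler_space M A g F" "c \<in> A"
  shows "kaehler_chart (chart_im c) (g c) (F c)"
proof
  have psr: "smooth_manifold M A" "tensor_field_02 A g" "tensor_field_11 A F"
    using assms(1) by (auto simp: kaehler_space_def pseudo_riemannian_def)
  show "open (chart_im c)"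
    using psr(1) assms(2) by (simp add: smooth_manifold_def is_chart_def)
  show "msmooth (chart_im c) (g c)" "msmooth (chart_im c) (F c)"
    using psr(2,3) assms(2) by (simp_all add: tensor_field_02_def tensor_field_11_def msmooth_def)
  fix x assume x: "x \<in> chart_im c"
  have sym: "g c x $ i $ j = g c x $ j $ i" and inv: "invertible (g c x)" for i j
    using assms x unfolding kaehler_space_def pseudo_riemannian_def by blast+
  have sq: "(\<Sum>m\<in>UNIV. F c x $ h $ m * F c x $ m $ i) = - (if h = i then 1 else 0)"
    and comp: "(\<Sum>m\<in>UNIV. F c x $ m $ i * g c x $ m $ j) + (\<Sum>m\<in>UNIV. F c x $ m $ j * g c x $ m $ i) = 0"
    and par: "cov_deriv_11 (g c) (F c) h i j x = 0" for h i j
    using assms x unfolding kaehler_space_def by blast+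
  show "transpose (g c x) = g c x"
    unfolding transpose_def vec_eq_iff using sym by (metis vec_lambda_beta)
  show "invertible (g c x)" by (rule inv)
  show "F c x ** F c x = - mat 1"
    by (simp add: vec_eq_iff matrix_matrix_mult_def sq mat_def)
  show "transpose (F c x) ** g c x = - (g c x ** F c x)"
  proof -
    have "(g c x ** F c x) $ i $ j = (\<Sum>m\<in>UNIV. F c x $ m $ j * g c x $ m $ i)" for i j
      by (simp add: matrix_matrix_mult_def sym[of i] mult.commute)
    moreover have "(transpose (F c x) ** g c x) $ i $ j = (\<Sum>m\<in>UNIV. F c x $ m $ i * g c x $ m $ j)" for i j
      by (simp add: matrix_matrix_mult_def transpose_def)
    ultimately show ?thesis
      using comp by (simp add: vec_eq_iff eq_neg_iff_add_eq_0)
  qed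
  show "mpartial k (F c) x = F c x ** Gam (g c) k x - Gam (g c) k x ** F c x" for k
    using par[of _ _ k]
    by (simp add: vec_eq_iff mpartial_def Gam_def matrix_matrix_mult_def cov_deriv_11_def mult.commute
        algebra_simps)
qed

theorem theorem2:
  fixes M :: "'a topology"
    and A :: "('a, 'n::finite) chart set"
    and g F :: "('a, 'n) mat_comps"
  assumes "kaehler_space M A g F"
    and "CARD('n) > 2"
  shows
    "((\<forall>c\<in>A. \<forall>x\<in>chart_im c. \<forall>i j k.
         cov_deriv_02 (g c) (energy_momentum (g c)) i j k x
         - cov_deriv_02 (g c) (energy_momentum (g c)) i k j x = 0)
      \<or>
      (\<exists>a b. covector_field A a \<and> covector_field A b \<and>
         (\<forall>c\<in>A. \<forall>x\<in>chart_im c. \<forall>i j k.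
            cov_deriv_02 (g c) (energy_momentum (g c)) i j k x =
              a c x $ k * g c x $ i $ j + b c x $ i * g c x $ j $ k + b c x $ j * g c x $ i $ k)))
     \<longleftrightarrow>
     (\<forall>c\<in>A. \<forall>x\<in>chart_im c. \<forall>i j k.
         cov_deriv_02 (g c) (energy_momentum (g c)) i j k x = 0) \<and>
     (\<forall>c\<in>A. \<forall>x\<in>chart_im c. \<forall>i j k.
         cov_deriv_02 (g c) (ricci (g c)) i j k x = 0)"
  (is "?O2 \<or> ?O3 \<longleftrightarrow> ?T \<and> ?R")
proof
  assume O: "?O2 \<or> ?O3"
  \<comment> \<open>Either global alternative restricts to the given chart and point, where the
    corresponding chart lemma applies.\<close>
  have T: "cov (g c) k (energy_momentum (g c)) x = 0" if c: "c \<in> A" and x: "x \<in> chart_im c" for c x k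
    using O
  proof
    assume O2: ?O2
    show ?thesis
    proof (rule kaehler_chart.codazzi_vanish[OF kaehler_space_chart[OF assms(1) c] x])
      fix i j k
      have "cov_deriv_02 (g c) (energy_momentum (g c)) i j k x
         - cov_deriv_02 (g c) (energy_momentum (g c)) i k j x = 0"
        using O2 c x by blast
      then show "cov (g c) k (energy_momentum (g c)) x $ i $ j = cov (g c) j (energy_momentum (g c)) x $ i $ k"
        by (simp add: cov_deriv_02_eq)
    qed
  next
    assume ?O3
    then obtain a b where ab: "\<forall>c\<in>A. \<forall>x\<in>chart_im c. \<forall>i j k.
            cov_deriv_02 (g c) (energy_momentum (g c)) i j k x =
              a c x $ k * g c x $ i $ j + b c x $ i * g c x $ j $ k + b c x $ j * g c x $ i $ k"
      by blast
    show ?thesis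
      by (rule kaehler_chart.omega3_vanish[OF kaehler_space_chart[OF assms(1) c] x assms(2), of "a c x" "b c x"])
        (use ab c x in \<open>simp add: cov_deriv_02_eq\<close>)
  qed
  have "cov (g c) k (ricci (g c)) x = 0" if c: "c \<in> A" and x: "x \<in> chart_im c" for c x k
    by (rule kaehler_chart.ricci_parallel[OF kaehler_space_chart[OF assms(1) c] x assms(2) T[OF c x]])
  with T show "?T \<and> ?R"
    by (simp add: cov_deriv_02_eq)
next
  assume "?T \<and> ?R"
  \<comment> \<open>A parallel tensor satisfies the Codazzi condition trivially, so the first
    alternative holds.\<close>
  then show "?O2 \<or> ?O3" by simp
qed

end
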